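(* Let $(G,\tau)$ be a compact Hausdorff right topological group. Then $G$ has a right invariant Haar measure if and only if $\mathcal{M}_\sigma(G)$ contains a non-zero measure.
   Context: A right topological group is a group $G$ with a topology $\tau$ such that for every $x\in G$ the map $g\mapsto gx$ is continuous. A right invariant Haar measure on a compact right topological group $G$ is a Radon probability measure $\lambda$ with $\lambda(Eg)=\lambda(E)$ for all $g\in G$ and Borel $E\subset G$. The $\sigma$-topology on $G$ is the quotient topology on $G$ induced by $(G,\tau)\times(G,\tau)\to G$, $(x,y)\mapsto x^{-1}y$. $C(G)$ and $C(G,\sigma)$ are the continuous complex functions on $(G,\tau)$ and $(G,\sigma)$; $M(G)=C(G)^*$ is the space of complex Radon measures on $(G,\tau)$. For $f\in C(G)$ and $\mu\in M(G)$, $(f\cdot\mu)(y)=\int f(xy)\,d\mu(x)$. Define $\mathcal{M}_\sigma(G)=\{\mu\in M(G): f\cdot\mu\in C(G,\sigma)\text{ for each }f\in C(G)\}$. *)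

theory Defs
  imports "HOL-Analysis.Analysis" "HOL-Algebra.Coset"
begin

section \<open>Right topological groups and the sigma-topology\<close>

locale right_topological_group = group G for G (structure) +
  fixes T :: "'a topology"
  assumes topspace_eq: "topspace T = carrier G"
    and continuous_right_mult:
      "\<And>x. x \<in> carrier G \<Longrightarrow> continuous_map T T (\<lambda>g. g \<otimes> x)"

definition sigma_topology :: "('a, 'm) monoid_scheme \<Rightarrow> 'a topology \<Rightarrow> 'a topology" where
  "sigma_topology G T =
     topology (\<lambda>U. U \<subseteq> carrier G \<and>
       openin (prod_topology T T)
         {p \<in> topspace (prod_topology T T). inv\<^bsub>G\<^esub> (fst p) \<otimes>\<^bsub>G\<^esub> snd p \<in> U})"

lemma openin_sigma_topology:
  "openin (sigma_topology G T) U \<longleftrightarrow>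
     U \<subseteq> carrier G \<and>
       openin (prod_topology T T)
         {p \<in> topspace (prod_topology T T). inv\<^bsub>G\<^esub> (fst p) \<otimes>\<^bsub>G\<^esub> snd p \<in> U}"
proof -
  let ?pre = "\<lambda>U. {p \<in> topspace (prod_topology T T). inv\<^bsub>G\<^esub> (fst p) \<otimes>\<^bsub>G\<^esub> snd p \<in> U}"
  have Int: "?pre (A \<inter> B) = ?pre A \<inter> ?pre B" for A B by auto
  have Un: "?pre (\<Union>K) = \<Union>(?pre ` K)" for K by auto
  have "istopology (\<lambda>U. U \<subseteq> carrier G \<and> openin (prod_topology T T) (?pre U))"
    unfolding istopology_def
  proof (intro conjI allI impI)
    fix A B
    assume "A \<subseteq> carrier G \<and> openin (prod_topology T T) (?pre A)"
      and "B \<subseteq> carrier G \<and> openin (prod_topology T T) (?pre B)"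
    then show "A \<inter> B \<subseteq> carrier G" "openin (prod_topology T T) (?pre (A \<inter> B))"
      unfolding Int by (blast, blast intro: openin_Int)
  next
    fix K
    assume K: "\<forall>U\<in>K. U \<subseteq> carrier G \<and> openin (prod_topology T T) (?pre U)"
    then show "\<Union>K \<subseteq> carrier G" by blast
    show "openin (prod_topology T T) (?pre (\<Union>K))"
      unfolding Un using K by (blast intro: openin_Union)
  qed
  then show ?thesis
    unfolding sigma_topology_def by (simp only: topology_inverse')
qed

lemma (in right_topological_group) topspace_sigma_topology:
  "topspace (sigma_topology G T) = carrier G"
proof -
  have "{p \<in> topspace (prod_topology T T). inv (fst p) \<otimes> snd p \<in> carrier G}
      = topspace (prod_topology T T)"
    unfolding topspace_prod_topology topspace_eq by auto
  then have "openin (sigma_topology G T) (carrier G)"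
    unfolding openin_sigma_topology by (intro conjI subset_refl) (erule ssubst, rule openin_topspace)
  moreover have "topspace (sigma_topology G T) \<subseteq> carrier G"
    using openin_topspace by (rule openin_sigma_topology[THEN iffD1, THEN conjunct1])
  ultimately show ?thesis
    using openin_subset by (intro subset_antisym)
qed

lemma (in right_topological_group) quotient_map_sigma_topology:
  "quotient_map (prod_topology T T) (sigma_topology G T) (\<lambda>(x, y). inv x \<otimes> y)"
proof -
  have "g \<in> (\<lambda>(x, y). inv x \<otimes> y) ` (carrier G \<times> carrier G)" if "g \<in> carrier G" for g
    using that by (intro image_eqI[of _ _ "(\<one>, g)"]) auto
  then show ?thesis
    unfolding quotient_map_def topspace_sigma_topology openin_sigma_topology
    by (auto simp: topspace_eq case_prod_unfold)
qed

section \<open>Radon measures\<close>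

definition borel_sets :: "'a topology \<Rightarrow> 'a set set" where
  "borel_sets T = sigma_sets (topspace T) {U. openin T U}"

text \<open>On a Hausdorff space, a finite Borel measure that is inner regular on all Borel
  sets is Radon in the usual sense; if the space is moreover compact, outer regularity
  follows by taking complements.\<close>

definition finite_radon_measure :: "'a topology \<Rightarrow> 'a measure \<Rightarrow> bool" where
  "finite_radon_measure T M \<longleftrightarrow>
     space M = topspace T \<and> sets M = borel_sets T \<and> finite_measure M \<and>
     (\<forall>E\<in>borel_sets T. emeasure M E =
        (SUP K\<in>{K. compactin T K \<and> K \<subseteq> E}. emeasure M K))"

text \<open>The positive variation of a real countably additive set function \<open>\<nu>\<close> in its Jordan
  decomposition is \<open>E \<mapsto> sup {\<nu> F | F \<subseteq> E Borel}\<close>, and the negative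
  variation of \<open>\<nu>\<close> is the positive variation of \<open>-\<nu>\<close>.  The coercion
  \<open>ennreal\<close> truncates negative values to 0, which does not affect the supremum since
  \<open>F = {}\<close> contributes 0.\<close>

definition pos_variation :: "'a topology \<Rightarrow> ('a set \<Rightarrow> real) \<Rightarrow> 'a measure" where
  "pos_variation T \<nu> = measure_of (topspace T) (borel_sets T)
     (\<lambda>E. SUP F\<in>{F \<in> borel_sets T. F \<subseteq> E}. ennreal (\<nu> F))"

definition neg_variation :: "'a topology \<Rightarrow> ('a set \<Rightarrow> real) \<Rightarrow> 'a measure" where
  "neg_variation T \<nu> = pos_variation T (\<lambda>E. - \<nu> E)"

text \<open>The space \<open>M(X)\<close> of complex Radon measures: complex countably additive set functions
  on the Borel sets such that the positive and negative variations of the real and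
  imaginary parts are Radon.  Set functions are normalised to vanish off the Borel sets,
  so that two complex measures agree iff they are equal as functions.\<close>

definition complex_radon_measures :: "'a topology \<Rightarrow> ('a set \<Rightarrow> complex) set" where
  "complex_radon_measures T = {\<mu>.
     (\<forall>E. E \<notin> borel_sets T \<longrightarrow> \<mu> E = 0) \<and>
     (\<forall>A :: nat \<Rightarrow> 'a set. range A \<subseteq> borel_sets T \<longrightarrow> disjoint_family A \<longrightarrow>
        (\<lambda>n. \<mu> (A n)) sums \<mu> (\<Union>n. A n)) \<and>
     finite_radon_measure T (pos_variation T (\<lambda>E. Re (\<mu> E))) \<and>
     finite_radon_measure T (neg_variation T (\<lambda>E. Re (\<mu> E))) \<and>
     finite_radon_measure T (pos_variation T (\<lambda>E. Im (\<mu> E))) \<and>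
     finite_radon_measure T (neg_variation T (\<lambda>E. Im (\<mu> E)))}"

definition complex_integral ::
    "'a topology \<Rightarrow> ('a set \<Rightarrow> complex) \<Rightarrow> ('a \<Rightarrow> complex) \<Rightarrow> complex" where
  "complex_integral T \<mu> f =
     (integral\<^sup>L (pos_variation T (\<lambda>E. Re (\<mu> E))) f
        - integral\<^sup>L (neg_variation T (\<lambda>E. Re (\<mu> E))) f)
     + \<i> * (integral\<^sup>L (pos_variation T (\<lambda>E. Im (\<mu> E))) f
        - integral\<^sup>L (neg_variation T (\<lambda>E. Im (\<mu> E))) f)"

section \<open>Haar measure and the space of sigma-continuous measures\<close>

definition right_haar_measure ::
    "('a, 'm) monoid_scheme \<Rightarrow> 'a topology \<Rightarrow> 'a measure \<Rightarrow> bool" where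
  "right_haar_measure G T M \<longleftrightarrow>
     finite_radon_measure T M \<and> emeasure M (topspace T) = 1 \<and>
     (\<forall>g\<in>carrier G. \<forall>E\<in>borel_sets T. emeasure M (E #>\<^bsub>G\<^esub> g) = emeasure M E)"

definition cont_functions :: "'a topology \<Rightarrow> ('a \<Rightarrow> complex) set" where
  "cont_functions T = {f. continuous_map T euclidean f}"

definition fun_measure_act ::
    "('a, 'm) monoid_scheme \<Rightarrow> 'a topology \<Rightarrow> ('a \<Rightarrow> complex) \<Rightarrow> ('a set \<Rightarrow> complex) \<Rightarrow> 'a \<Rightarrow> complex"
  where
  "fun_measure_act G T f \<mu> y = complex_integral T \<mu> (\<lambda>x. f (x \<otimes>\<^bsub>G\<^esub> y))"

definition M_sigma :: "('a, 'm) monoid_scheme \<Rightarrow> 'a topology \<Rightarrow> ('a set \<Rightarrow> complex) set" where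
  "M_sigma G T = {\<mu> \<in> complex_radon_measures T.
     \<forall>f \<in> cont_functions T. fun_measure_act G T f \<mu> \<in> cont_functions (sigma_topology G T)}"

end

theory Submission
  imports Defs
begin

text \<open>A right Haar measure itself lies in \<open>M_sigma\<close>, because its \<open>f \<cdot> \<mu>\<close> are constant.
  Conversely, let \<open>J\<close> be the integral against the real or imaginary part of a non-zero
  \<open>\<mu>\<close>.  Every \<open>\<sigma>\<close>-continuous function is almost periodic on the abstract group, hence has
  a translation invariant mean \<open>m\<close>.  For \<open>f \<ge> 0\<close> let \<open>\<Phi>\<^sub>f(y)\<close> be the positive variation at \<open>f\<close>
  of the translate of \<open>J\<close> by \<open>y\<close>, a supremum of \<open>\<sigma>\<close>-continuous functions of \<open>y\<close>, and put
  \<open>\<Lambda> f = sup {m v | v \<le> \<Phi>\<^sub>f}\<close> over \<open>\<sigma>\<close>-continuous \<open>v\<close>.  Compactness makes \<open>\<Lambda>\<close> additive, and it is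
  right invariant because \<open>\<Phi>\<close> of a translate of \<open>f\<close> is a translate of \<open>\<Phi>\<^sub>f\<close>.  Since \<open>\<Phi>\<^sub>1\<close> is
  a positive constant, \<open>\<Lambda>\<close> is non-zero even when \<open>\<mu>(G) = 0\<close>, and the Riesz construction turns
  it into a Haar measure.\<close>

section \<open>Means of almost periodic functions\<close>

text \<open>The mean of \<open>f \<cdot> \<mu>\<close> itself would already be linear and right
  invariant in f, but in general it is not positive, and it gives the constant 1 the value \<mu>(G);
  for \<mu> = delta_a - delta_b on a finite group it vanishes identically. Hence the positive
  variation is taken at each y before averaging. The price is that the resulting function of y is
  only a supremum of sigma-continuous ones, for which no mean is available, so it is approached from
  below. Superadditivity is then formal, and the opposite inequality needs a Dini-type argument. The
  mean m has its own obstacle: two right averages need not commute, so nothing compares them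
  directly. Left averages commute with right ones by associativity, and a nearly constant left
  average decides the value of every nearly constant right average. This is why existence,
  uniqueness, additivity and invariance of m all pass through the opposite group. The theory of m is
  pure group theory, so the one-sided continuity of the multiplication does no harm there.\<close>

definition opposite :: "('a, 'm) monoid_scheme \<Rightarrow> ('a, 'm) monoid_scheme" where
  "opposite G = G\<lparr>mult := \<lambda>x y. y \<otimes>\<^bsub>G\<^esub> x\<rparr>"

lemma opposite_simps [simp]:
  "carrier (opposite G) = carrier G"
  "x \<otimes>\<^bsub>opposite G\<^esub> y = y \<otimes>\<^bsub>G\<^esub> x"
  "\<one>\<^bsub>opposite G\<^esub> = \<one>\<^bsub>G\<^esub>"
  "opposite (opposite G) = G"
  by (simp_all add: opposite_def)

text \<open>Left averages over \<open>G\<close> are right averages over \<open>opposite G\<close>.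
  Interpreting \<open>group\<close> at \<open>opposite G\<close> therefore yields the left-hand
  version of each lemma on averages.\<close>

lemma (in group) group_opposite: "group (opposite G)"
proof (rule groupI)
  fix x assume "x \<in> carrier (opposite G)"
  then show "\<exists>y\<in>carrier (opposite G). y \<otimes>\<^bsub>opposite G\<^esub> x = \<one>\<^bsub>opposite G\<^esub>"
    by (intro bexI[of _ "inv x"]) auto
qed (auto simp: m_assoc)

text \<open>Averages are operators, not convex combinations attached to one function: the same
  \<open>A\<close> is applied to \<open>v\<close>, \<open>w\<close> and their sum, operators
  compose, and right ones commute with left ones.\<close>

inductive right_average ::
    "('a, 'm) monoid_scheme \<Rightarrow> (('a \<Rightarrow> real) \<Rightarrow> 'a \<Rightarrow> real) \<Rightarrow> bool" for G (structure) where
  id: "right_average G (\<lambda>v. v)"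
| average: "\<lbrakk>right_average G A; finite S; S \<noteq> {}; S \<subseteq> carrier G\<rbrakk>
    \<Longrightarrow> right_average G (\<lambda>v x. (\<Sum>s\<in>S. A v (x \<otimes> s)) / real (card S))"

lemma right_average_compose:
  "right_average G A \<Longrightarrow> right_average G B \<Longrightarrow> right_average G (\<lambda>v. A (B v))"
  by (induction rule: right_average.induct) (auto intro: right_average.intros)

lemma average_le:
  assumes "finite S" "S \<noteq> {}" "\<And>s. s \<in> S \<Longrightarrow> f s \<le> (b::real)"
  shows "(\<Sum>s\<in>S. f s) / real (card S) \<le> b"
proof -
  have "(\<Sum>s\<in>S. f s) \<le> real (card S) * b"
    using sum_bounded_above[of S f b] assms by simp
  then show ?thesis
    using assms by (simp add: divide_le_eq mult.commute card_gt_0_iff)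
qed

lemma average_ge:
  assumes "finite S" "S \<noteq> {}" "\<And>s. s \<in> S \<Longrightarrow> (b::real) \<le> f s"
  shows "b \<le> (\<Sum>s\<in>S. f s) / real (card S)"
proof -
  have "real (card S) * b \<le> (\<Sum>s\<in>S. f s)"
    using sum_bounded_below[of S b f] assms by simp
  then show ?thesis
    using assms by (simp add: le_divide_eq mult.commute card_gt_0_iff)
qed

section \<open>Order, linearity and commutation of averaging operators\<close>

context group begin

lemma right_average_mono:
  assumes "right_average G A" "\<And>x. x \<in> carrier G \<Longrightarrow> v x \<le> w x" "x \<in> carrier G"
  shows "A v x \<le> A w x"
  using assms(1,3)
proof (induction arbitrary: x rule: right_average.induct)
  case (average A S)
  then have "(\<Sum>s\<in>S. A v (x \<otimes> s)) \<le> (\<Sum>s\<in>S. A w (x \<otimes> s))"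
    by (intro sum_mono) auto
  then show ?case by (simp add: divide_right_mono)
qed (use assms in auto)

lemma right_average_cong:
  assumes "right_average G A" "\<And>x. x \<in> carrier G \<Longrightarrow> v x = w x" "x \<in> carrier G"
  shows "A v x = A w x"
  using right_average_mono[of A v w x] right_average_mono[of A w v x] assms by force

lemma right_average_const:
  "right_average G A \<Longrightarrow> A (\<lambda>x. c) x = c"
  by (induction arbitrary: x rule: right_average.induct) auto

lemma right_average_add:
  "right_average G A \<Longrightarrow> A (\<lambda>x. v x + w x) x = A v x + A w x"
  by (induction arbitrary: x rule: right_average.induct) (auto simp: sum.distrib add_divide_distrib)

lemma right_average_divide:
  "right_average G A \<Longrightarrow> A (\<lambda>x. v x / c) x = A v x / c"
  by (induction arbitrary: x rule: right_average.induct) (auto simp: sum_divide_distrib[symmetric])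

lemma right_average_sum:
  assumes "right_average G A"
  shows "A (\<lambda>x. \<Sum>s\<in>S. w s x) x = (\<Sum>s\<in>S. A (w s) x)"
  by (induction S rule: infinite_finite_induct)
    (simp_all add: right_average_const[OF assms] right_average_add[OF assms])

lemma right_average_translate:
  "right_average G A \<Longrightarrow> h \<in> carrier G \<Longrightarrow> x \<in> carrier G \<Longrightarrow> A (\<lambda>x. v (h \<otimes> x)) x = A v (h \<otimes> x)"
proof (induction arbitrary: x rule: right_average.induct)
  case (average A S)
  then have "(\<Sum>s\<in>S. A (\<lambda>x. v (h \<otimes> x)) (x \<otimes> s)) = (\<Sum>s\<in>S. A v (h \<otimes> x \<otimes> s))"
    by (intro sum.cong refl) (auto simp: m_assoc subset_iff)
  then show ?case by simp
qed auto

text \<open>A left average is a finite mean of left translates, and \<open>A\<close>, being linear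
  and built from right translations, passes through each of them by associativity.\<close>

lemma right_left_average_commute:
  assumes A: "right_average G A" and B: "right_average (opposite G) B" and "x \<in> carrier G"
  shows "A (B v) x = B (A v) x"
  using B assms(3)
proof (induction arbitrary: x rule: right_average.induct)
  case (average B S)
  have "A (\<lambda>x. (\<Sum>s\<in>S. B v (s \<otimes> x)) / real (card S)) x
      = (\<Sum>s\<in>S. A (\<lambda>x. B v (s \<otimes> x)) x) / real (card S)"
    by (simp add: right_average_divide[OF A] right_average_sum[OF A])
  also have "(\<Sum>s\<in>S. A (\<lambda>x. B v (s \<otimes> x)) x) = (\<Sum>s\<in>S. B (A v) (s \<otimes> x))"
    using average by (intro sum.cong refl) (auto simp: right_average_translate[OF A] subset_iff)
  finally show ?case by simp
qed auto

end

text \<open>Essentially Maak's form of almost periodicity. The free factors on both sides make it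
  symmetric under \<open>opposite\<close>, and the right one lets it pass to right averages.\<close>

definition almost_periodic :: "('a, 'm) monoid_scheme \<Rightarrow> ('a \<Rightarrow> real) \<Rightarrow> bool" where
  "almost_periodic G v \<longleftrightarrow> (\<forall>\<epsilon>>0. \<exists>S. finite S \<and> S \<subseteq> carrier G \<and>
     (\<forall>g\<in>carrier G. \<exists>s\<in>S. \<forall>x\<in>carrier G. \<forall>y\<in>carrier G.
        \<bar>v (x \<otimes>\<^bsub>G\<^esub> g \<otimes>\<^bsub>G\<^esub> y) - v (x \<otimes>\<^bsub>G\<^esub> s \<otimes>\<^bsub>G\<^esub> y)\<bar> \<le> \<epsilon>))"

text \<open>Von Neumann's mean value, seen from one side. The value \<open>c\<close> becomes
  canonical only when confronted with a left mean, in \<open>right_left_mean_eq\<close>.\<close>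

definition right_mean :: "('a, 'm) monoid_scheme \<Rightarrow> ('a \<Rightarrow> real) \<Rightarrow> real \<Rightarrow> bool" where
  "right_mean G v c \<longleftrightarrow>
     (\<forall>\<epsilon>>0. \<exists>A. right_average G A \<and> (\<forall>x\<in>carrier G. \<bar>A v x - c\<bar> \<le> \<epsilon>))"

section \<open>Almost periodic functions and their nearly constant averages\<close>

context group begin

lemma almost_periodic_opposite:
  assumes "almost_periodic G v"
  shows "almost_periodic (opposite G) v"
  unfolding almost_periodic_def
proof (intro allI impI)
  fix \<epsilon> :: real assume "\<epsilon> > 0"
  with assms obtain S where S: "finite S" "S \<subseteq> carrier G"
    "\<And>g. g \<in> carrier G \<Longrightarrow> \<exists>s\<in>S. \<forall>x\<in>carrier G. \<forall>y\<in>carrier G.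
        \<bar>v (x \<otimes> g \<otimes> y) - v (x \<otimes> s \<otimes> y)\<bar> \<le> \<epsilon>"
    unfolding almost_periodic_def by metis
  show "\<exists>S. finite S \<and> S \<subseteq> carrier (opposite G) \<and>
     (\<forall>g\<in>carrier (opposite G). \<exists>s\<in>S. \<forall>x\<in>carrier (opposite G). \<forall>y\<in>carrier (opposite G).
        \<bar>v (x \<otimes>\<^bsub>opposite G\<^esub> g \<otimes>\<^bsub>opposite G\<^esub> y) - v (x \<otimes>\<^bsub>opposite G\<^esub> s \<otimes>\<^bsub>opposite G\<^esub> y)\<bar> \<le> \<epsilon>)"
  proof (intro exI[of _ S] conjI ballI)
    fix g assume "g \<in> carrier (opposite G)"
    then obtain s where "s \<in> S" and s: "\<And>x y. x \<in> carrier G \<Longrightarrow> y \<in> carrier G \<Longrightarrow>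
        \<bar>v (x \<otimes> g \<otimes> y) - v (x \<otimes> s \<otimes> y)\<bar> \<le> \<epsilon>" using S(3)[of g] by auto
    then show "\<exists>s\<in>S. \<forall>x\<in>carrier (opposite G). \<forall>y\<in>carrier (opposite G).
        \<bar>v (x \<otimes>\<^bsub>opposite G\<^esub> g \<otimes>\<^bsub>opposite G\<^esub> y) - v (x \<otimes>\<^bsub>opposite G\<^esub> s \<otimes>\<^bsub>opposite G\<^esub> y)\<bar> \<le> \<epsilon>"
      using S \<open>g \<in> carrier (opposite G)\<close> by (intro bexI[of _ s]) (auto simp: m_assoc[symmetric] subset_iff)
  qed (use S in auto)
qed

text \<open>The extra factor \<open>t\<close> of an average is absorbed into \<open>y\<close>, so an
  estimate that is uniform in \<open>y\<close> survives with the same \<open>g\<close>,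
  \<open>s\<close> and \<epsilon>.\<close>

lemma right_average_modulus:
  assumes "right_average G A" "g \<in> carrier G" "s \<in> carrier G"
    and "\<And>x y. x \<in> carrier G \<Longrightarrow> y \<in> carrier G \<Longrightarrow> \<bar>v (x \<otimes> g \<otimes> y) - v (x \<otimes> s \<otimes> y)\<bar> \<le> \<epsilon>"
    and "x \<in> carrier G" "y \<in> carrier G"
  shows "\<bar>A v (x \<otimes> g \<otimes> y) - A v (x \<otimes> s \<otimes> y)\<bar> \<le> \<epsilon>"
  using assms(1,5,6)
proof (induction arbitrary: x y rule: right_average.induct)
  case (average A S)
  have "\<bar>(\<Sum>t\<in>S. A v (x \<otimes> g \<otimes> y \<otimes> t)) - (\<Sum>t\<in>S. A v (x \<otimes> s \<otimes> y \<otimes> t))\<bar>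
      = \<bar>\<Sum>t\<in>S. A v (x \<otimes> g \<otimes> (y \<otimes> t)) - A v (x \<otimes> s \<otimes> (y \<otimes> t))\<bar>"
    unfolding sum_subtractf[symmetric]
    by (intro arg_cong[where f = abs] sum.cong) (use average assms in \<open>auto simp: m_assoc subset_iff\<close>)
  also have "\<dots> \<le> (\<Sum>t\<in>S. \<bar>A v (x \<otimes> g \<otimes> (y \<otimes> t)) - A v (x \<otimes> s \<otimes> (y \<otimes> t))\<bar>)"
    by (rule sum_abs)
  finally have "\<bar>(\<Sum>t\<in>S. A v (x \<otimes> g \<otimes> y \<otimes> t)) - (\<Sum>t\<in>S. A v (x \<otimes> s \<otimes> y \<otimes> t))\<bar> / card S
      \<le> (\<Sum>t\<in>S. \<bar>A v (x \<otimes> g \<otimes> (y \<otimes> t)) - A v (x \<otimes> s \<otimes> (y \<otimes> t))\<bar>) / card S"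
    by (simp add: divide_right_mono)
  also have "\<dots> \<le> \<epsilon>"
    using average by (intro average_le) auto
  finally show ?case by (simp add: diff_divide_distrib[symmetric])
qed (use assms in auto)

lemma almost_periodic_right_average:
  assumes "almost_periodic G v" "right_average G A"
  shows "almost_periodic G (A v)"
  unfolding almost_periodic_def
proof (intro allI impI)
  fix \<epsilon> :: real assume "\<epsilon> > 0"
  with assms(1) obtain S where S: "finite S" "S \<subseteq> carrier G"
    "\<And>g. g \<in> carrier G \<Longrightarrow> \<exists>s\<in>S. \<forall>x\<in>carrier G. \<forall>y\<in>carrier G.
        \<bar>v (x \<otimes> g \<otimes> y) - v (x \<otimes> s \<otimes> y)\<bar> \<le> \<epsilon>"
    unfolding almost_periodic_def by metis
  show "\<exists>S. finite S \<and> S \<subseteq> carrier G \<and>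
     (\<forall>g\<in>carrier G. \<exists>s\<in>S. \<forall>x\<in>carrier G. \<forall>y\<in>carrier G.
        \<bar>A v (x \<otimes> g \<otimes> y) - A v (x \<otimes> s \<otimes> y)\<bar> \<le> \<epsilon>)"
    using S(1,2)
  proof (intro exI[of _ S] conjI ballI)
    fix g assume g: "g \<in> carrier G"
    from S(3)[OF g] obtain s where s: "s \<in> S" "\<forall>x\<in>carrier G. \<forall>y\<in>carrier G.
        \<bar>v (x \<otimes> g \<otimes> y) - v (x \<otimes> s \<otimes> y)\<bar> \<le> \<epsilon>" by blast
    then show "\<exists>s\<in>S. \<forall>x\<in>carrier G. \<forall>y\<in>carrier G.
        \<bar>A v (x \<otimes> g \<otimes> y) - A v (x \<otimes> s \<otimes> y)\<bar> \<le> \<epsilon>"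
      using S(2) g by (intro bexI[of _ s] ballI right_average_modulus[OF assms(2)]) auto
  qed
qed

lemma almost_periodic_bounded:
  assumes "almost_periodic G v"
  obtains B where "\<And>x. x \<in> carrier G \<Longrightarrow> \<bar>v x\<bar> \<le> B"
proof -
  obtain S where S: "finite S" "S \<subseteq> carrier G"
    "\<And>g. g \<in> carrier G \<Longrightarrow> \<exists>s\<in>S. \<forall>x\<in>carrier G. \<forall>y\<in>carrier G.
        \<bar>v (x \<otimes> g \<otimes> y) - v (x \<otimes> s \<otimes> y)\<bar> \<le> 1"
    using assms unfolding almost_periodic_def by (metis zero_less_one)
  have "\<bar>v x\<bar> \<le> (\<Sum>s\<in>S. \<bar>v s\<bar>) + 1" if x: "x \<in> carrier G" for x
  proof -
    obtain s where s: "s \<in> S" "\<forall>a\<in>carrier G. \<forall>b\<in>carrier G. \<bar>v (a \<otimes> x \<otimes> b) - v (a \<otimes> s \<otimes> b)\<bar> \<le> 1"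
      using S(3)[OF x] by blast
    have "\<bar>v x - v s\<bar> \<le> 1"
      using s(2)[rule_format, of \<one> \<one>] x s(1) S(2) by auto
    moreover have "\<bar>v s\<bar> \<le> (\<Sum>s\<in>S. \<bar>v s\<bar>)"
      using s(1) S(1) by (intro member_le_sum) auto
    ultimately show ?thesis by linarith
  qed
  then show ?thesis by (rule that)
qed

text \<open>Averaging over an \<open>\<epsilon>\<close>-net with \<open>n\<close> elements makes every point see a value close to any
  prescribed value of \<open>v\<close> with weight \<open>1/n\<close>, so the oscillation contracts by the factor
  \<open>1 - 1/(2n)\<close> up to an error \<open>\<epsilon>/n\<close>; the same net serves for all averages of \<open>v\<close>.\<close>

lemma almost_periodic_flatten:
  assumes "almost_periodic G v" "\<epsilon> > 0"
  obtains A c where "right_average G A" "\<And>x. x \<in> carrier G \<Longrightarrow> \<bar>A v x - c\<bar> \<le> \<epsilon>"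
proof -
  \<comment> \<open>The induction below ends with an interval of length less than
    \<open>\<delta> + 2 * \<delta>\<close>.\<close>
  define \<delta> where "\<delta> = \<epsilon> / 3"
  have "\<delta> > 0" using assms by (simp add: \<delta>_def)
  with assms(1) obtain S where S: "finite S" "S \<subseteq> carrier G"
    "\<And>g. g \<in> carrier G \<Longrightarrow> \<exists>s\<in>S. \<forall>x\<in>carrier G. \<forall>y\<in>carrier G.
        \<bar>v (x \<otimes> g \<otimes> y) - v (x \<otimes> s \<otimes> y)\<bar> \<le> \<delta>"
    unfolding almost_periodic_def by metis
  have "S \<noteq> {}" using S(3)[OF one_closed] by blast
  define n where "n = real (card S)"
  have "n \<ge> 1"
    using S(1) \<open>S \<noteq> {}\<close> by (simp add: n_def Suc_le_eq card_gt_0_iff)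
  define q where "q = 1 - 1 / (2 * n)"
  have q: "1/2 \<le> q" "q < 1" using \<open>n \<ge> 1\<close> by (auto simp: q_def field_simps)
  obtain B where B: "\<And>x. x \<in> carrier G \<Longrightarrow> \<bar>v x\<bar> \<le> B"
    using almost_periodic_bounded[OF assms(1)] by blast
  \<comment> \<open>The summand \<open>2 * \<delta>\<close> is the fixed point of the recursion
    \<open>l \<mapsto> q * l + \<delta> / n\<close>, so the errors from the net do not
    accumulate.\<close>
  have step: "\<exists>A a b. right_average G A \<and> (\<forall>x\<in>carrier G. a \<le> A v x \<and> A v x \<le> b) \<and>
      b - a \<le> q ^ j * (2 * B) + 2 * \<delta>" for j
  proof (induction j)
    case 0
    show ?case
      using B \<open>\<delta> > 0\<close> by (intro exI[of _ "\<lambda>v. v"] exI[of _ "-B"] exI[of _ B])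
        (auto intro: right_average.id simp: abs_le_iff minus_le_iff)
  next
    case (Suc j)
    then obtain A a b where A: "right_average G A"
      and ab: "\<And>x. x \<in> carrier G \<Longrightarrow> a \<le> A v x" "\<And>x. x \<in> carrier G \<Longrightarrow> A v x \<le> b"
      and len: "b - a \<le> q ^ j * (2 * B) + 2 * \<delta>" by blast
    have "a \<le> b" using ab[OF one_closed] by simp
    define A' where "A' = (\<lambda>v x. (\<Sum>s\<in>S. A v (x \<otimes> s)) / n)"
    have A': "right_average G A'"
      unfolding A'_def n_def using A S \<open>S \<noteq> {}\<close> by (intro right_average.average)
    have A'_bounds: "a \<le> A' v x" "A' v x \<le> b" if "x \<in> carrier G" for x
      unfolding A'_def n_def using S that \<open>S \<noteq> {}\<close> ab
      by (intro average_ge average_le; force)+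
    have target: "q * (b - a) + \<delta> / n \<le> q ^ Suc j * (2 * B) + 2 * \<delta>"
    proof -
      have "q * (b - a) \<le> q * (q ^ j * (2 * B) + 2 * \<delta>)"
        using len q by (intro mult_left_mono) auto
      also have "\<dots> = q ^ Suc j * (2 * B) + 2 * \<delta> - \<delta> / n"
        using \<open>n \<ge> 1\<close> by (simp add: q_def field_simps)
      finally show ?thesis by simp
    qed
    show ?case
    proof (cases "\<exists>x0\<in>carrier G. A v x0 \<le> (a + b) / 2")
      case True
      then obtain x0 where x0: "x0 \<in> carrier G" "A v x0 \<le> (a + b) / 2" by blast
      have "A' v x \<le> ((n - 1) * b + (a + b) / 2 + \<delta>) / n" if x: "x \<in> carrier G" for x
      proof -
        have g: "inv x \<otimes> x0 \<in> carrier G" using x x0 by simp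
        \<comment> \<open>A net point \<open>s\<close> close to \<open>inv x \<otimes> x0\<close>
          makes \<open>x \<otimes> s\<close> behave like \<open>x0\<close>, where \<open>A v\<close>
          lies in the lower half of the interval.\<close>
        obtain s where s: "s \<in> S" "\<forall>y\<in>carrier G. \<forall>z\<in>carrier G.
            \<bar>v (y \<otimes> (inv x \<otimes> x0) \<otimes> z) - v (y \<otimes> s \<otimes> z)\<bar> \<le> \<delta>" using S(3)[OF g] by blast
        have "\<bar>A v (x \<otimes> (inv x \<otimes> x0) \<otimes> \<one>) - A v (x \<otimes> s \<otimes> \<one>)\<bar> \<le> \<delta>"
          using s S(2) x g by (intro right_average_modulus[OF A]) auto
        moreover have "x \<otimes> (inv x \<otimes> x0) \<otimes> \<one> = x0" "x \<otimes> s \<otimes> \<one> = x \<otimes> s"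
          using x x0(1) subsetD[OF S(2) s(1)] by (simp_all add: m_assoc[symmetric])
        ultimately have "\<bar>A v x0 - A v (x \<otimes> s)\<bar> \<le> \<delta>" by simp
        then have "A v (x \<otimes> s) \<le> (a + b) / 2 + \<delta>" using x0(2) by linarith
        moreover have "(\<Sum>s\<in>S - {s}. A v (x \<otimes> s)) \<le> real (card (S - {s})) * b"
          using S(2) x ab(2) by (intro sum_bounded_above) auto
        moreover have "real (card (S - {s})) = n - 1"
          using s(1) S(1) \<open>n \<ge> 1\<close> by (simp add: n_def of_nat_diff)
        ultimately have "(\<Sum>s\<in>S. A v (x \<otimes> s)) \<le> (n - 1) * b + (a + b) / 2 + \<delta>"
          using sum.remove[OF S(1) s(1), of "\<lambda>s. A v (x \<otimes> s)"] by simp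
        then show ?thesis using \<open>n \<ge> 1\<close> by (simp add: A'_def divide_right_mono)
      qed
      moreover have "((n - 1) * b + (a + b) / 2 + \<delta>) / n - a = q * (b - a) + \<delta> / n"
        using \<open>n \<ge> 1\<close> by (simp add: q_def field_simps)
      ultimately show ?thesis
        using A' A'_bounds target
        by (intro exI[of _ A'] exI[of _ a] exI[of _ "((n - 1) * b + (a + b) / 2 + \<delta>) / n"]) auto
    next
      \<comment> \<open>Without a low point the lower end moves up to the midpoint. This halves the
        interval, which is enough because \<open>1/2 \<le> q\<close>.\<close>
      case False
      have *: "(a + b) / 2 \<le> A v y" if "y \<in> carrier G" for y
        using False that by (meson linear)
      have "(a + b) / 2 \<le> A' v x" if x: "x \<in> carrier G" for x
        unfolding A'_def n_def
        by (intro average_ge S \<open>S \<noteq> {}\<close> * m_closed x) (use S(2) in blast)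
      moreover have "b - (a + b) / 2 \<le> q * (b - a) + \<delta> / n"
      proof -
        have "1/2 * (b - a) \<le> q * (b - a)"
          using q \<open>a \<le> b\<close> by (intro mult_right_mono) auto
        moreover have "0 \<le> \<delta> / n" using \<open>\<delta> > 0\<close> \<open>n \<ge> 1\<close> by simp
        moreover have "b - (a + b) / 2 = 1/2 * (b - a)" by (simp add: field_simps)
        ultimately show ?thesis by linarith
      qed
      ultimately show ?thesis
        using A' A'_bounds target
        by (intro exI[of _ A'] exI[of _ "(a + b) / 2"] exI[of _ b]) (auto intro: order_trans)
    qed
  qed
  have "(\<lambda>j. q ^ j * (2 * B)) \<longlonglongrightarrow> 0 * (2 * B)"
    using q by (intro tendsto_mult LIMSEQ_power_zero tendsto_const) auto
  then have "\<forall>\<^sub>F j in sequentially. q ^ j * (2 * B) < \<delta>"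
    using \<open>\<delta> > 0\<close> by (simp add: order_tendsto_iff)
  then obtain j where "q ^ j * (2 * B) < \<delta>"
    by (auto simp: eventually_sequentially)
  moreover obtain A a b where A: "right_average G A"
    and ab: "\<And>x. x \<in> carrier G \<Longrightarrow> a \<le> A v x \<and> A v x \<le> b" "b - a \<le> q ^ j * (2 * B) + 2 * \<delta>"
    using step[of j] by blast
  ultimately have "\<bar>A v x - a\<bar> \<le> \<epsilon>" if "x \<in> carrier G" for x
    using ab(1)[OF that] by (simp add: \<delta>_def)
  with A show ?thesis by (rule that)
qed

text \<open>The pivot of the theory of means: \<open>A (B v)\<close> and \<open>B (A v)\<close>
  coincide, the second is at least \<open>a\<close>, and the first is at most
  \<open>A (B w)\<close>, hence at most \<open>b\<close>.\<close>

lemma right_mean_cross: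
  assumes A: "right_average G A" and B: "right_average (opposite G) B"
    and a: "\<And>x. x \<in> carrier G \<Longrightarrow> a \<le> A v x"
    and vw: "\<And>x. x \<in> carrier G \<Longrightarrow> v x \<le> w x"
    and b: "\<And>x. x \<in> carrier G \<Longrightarrow> B w x \<le> b"
  shows "a \<le> b"
proof -
  interpret opp: group "opposite G" by (rule group_opposite)
  have "a = B (\<lambda>x. a) \<one>" by (rule opp.right_average_const[OF B, symmetric])
  also have "\<dots> \<le> B (A v) \<one>" by (rule opp.right_average_mono[OF B]) (simp_all add: a)
  also have "\<dots> = A (B v) \<one>" by (rule right_left_average_commute[OF A B, symmetric]) simp
  also have "\<dots> \<le> A (B w) \<one>"
    by (rule right_average_mono[OF A]) (auto intro!: opp.right_average_mono[OF B] simp: vw)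
  also have "\<dots> \<le> A (\<lambda>x. b) \<one>" by (rule right_average_mono[OF A]) (simp_all add: b)
  also have "\<dots> = b" by (rule right_average_const[OF A])
  finally show ?thesis .
qed

section \<open>Existence, uniqueness and invariance of the mean\<close>

lemma right_meanD:
  assumes "right_mean G v c" "\<epsilon> > 0"
  obtains A where "right_average G A" "\<And>x. x \<in> carrier G \<Longrightarrow> A v x \<le> c + \<epsilon>"
    "\<And>x. x \<in> carrier G \<Longrightarrow> c - \<epsilon> \<le> A v x"
proof -
  obtain A where A: "right_average G A" "\<forall>x\<in>carrier G. \<bar>A v x - c\<bar> \<le> \<epsilon>"
    using assms unfolding right_mean_def by blast
  then show ?thesis by (intro that[of A]) (simp_all add: abs_le_iff algebra_simps)
qed

lemma right_meanI:
  assumes "\<And>\<epsilon>::real. \<epsilon> > 0 \<Longrightarrow> \<exists>A. right_average G A \<and>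
    (\<forall>x\<in>carrier G. c - \<epsilon> \<le> A v x \<and> A v x \<le> c + \<epsilon>)"
  shows "right_mean G v c"
  unfolding right_mean_def abs_le_iff
proof (intro allI impI)
  fix \<epsilon> :: real assume "\<epsilon> > 0"
  from assms[OF this] obtain A where
    "right_average G A" "\<forall>x\<in>carrier G. c - \<epsilon> \<le> A v x \<and> A v x \<le> c + \<epsilon>" by blast
  then show "\<exists>A. right_average G A \<and> (\<forall>x\<in>carrier G. A v x - c \<le> \<epsilon> \<and> - (A v x - c) \<le> \<epsilon>)"
    by (intro exI[of _ A]) (simp add: algebra_simps)
qed

lemma right_left_mean_mono:
  assumes v: "right_mean G v c" and w: "right_mean (opposite G) w d"
    and vw: "\<And>x. x \<in> carrier G \<Longrightarrow> v x \<le> w x"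
  shows "c \<le> d"
proof (rule field_le_epsilon)
  fix \<epsilon> :: real assume "\<epsilon> > 0"
  then have "\<epsilon> / 2 > 0" by simp
  interpret opp: group "opposite G" by (rule group_opposite)
  obtain A where A: "right_average G A" "\<And>x. x \<in> carrier G \<Longrightarrow> A v x \<le> c + \<epsilon> / 2"
    "\<And>x. x \<in> carrier G \<Longrightarrow> c - \<epsilon> / 2 \<le> A v x"
    by (rule right_meanD[OF v \<open>\<epsilon> / 2 > 0\<close>]) (rule that, assumption+)
  obtain B where B: "right_average (opposite G) B" "\<And>x. x \<in> carrier G \<Longrightarrow> B w x \<le> d + \<epsilon> / 2"
    "\<And>x. x \<in> carrier G \<Longrightarrow> d - \<epsilon> / 2 \<le> B w x"
    by (rule opp.right_meanD[OF w \<open>\<epsilon> / 2 > 0\<close>, unfolded opposite_simps]) (rule that, assumption+)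
  have "c - \<epsilon> / 2 \<le> d + \<epsilon> / 2"
    by (rule right_mean_cross[OF A(1) B(1) A(3) vw B(2)])
  then show "c \<le> d + \<epsilon>" by simp
qed

lemma right_left_mean_eq:
  assumes "right_mean G v c" "right_mean (opposite G) v d"
  shows "c = d"
proof (rule antisym)
  interpret opp: group "opposite G" by (rule group_opposite)
  show "c \<le> d" using right_left_mean_mono[OF assms] by simp
  show "d \<le> c" using opp.right_left_mean_mono[of v d v c] assms by simp
qed

text \<open>\<open>almost_periodic_flatten\<close> gives a different constant for each \<epsilon>.
  \<open>Sup L\<close> merges them into one number; it is finite because an upper bound of any left
  average of \<open>v\<close> bounds \<open>L\<close> too.\<close>

lemma almost_periodic_right_mean:
  assumes "almost_periodic G v"
  obtains c where "right_mean G v c"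
proof -
  interpret opp: group "opposite G" by (rule group_opposite)
  define L where "L = {a. \<exists>A. right_average G A \<and> (\<forall>x\<in>carrier G. a \<le> A v x)}"
  have upper: "a \<le> b" if "a \<in> L" "right_average (opposite G) B" "\<And>x. x \<in> carrier G \<Longrightarrow> B v x \<le> b"
    for a b B
    using that right_mean_cross[of _ B a v v b] unfolding L_def by auto
  show ?thesis
  proof (rule that[of "Sup L"], rule right_meanI)
    fix \<epsilon> :: real assume "\<epsilon> > 0"
    \<comment> \<open>Four errors of this size separate \<open>Sup L - \<epsilon>\<close> from
      \<open>A v x\<close>: one from \<open>Sup L\<close> to \<open>d\<close>, two from
      \<open>d\<close> to \<open>c\<close>, one from \<open>c\<close> to
      \<open>A v x\<close>.\<close>
    then have \<epsilon>: "\<epsilon> / 4 > 0" by simp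
    obtain A c where A: "right_average G A" "\<And>x. x \<in> carrier G \<Longrightarrow> \<bar>A v x - c\<bar> \<le> \<epsilon> / 4"
      by (rule almost_periodic_flatten[OF assms \<epsilon>]) (rule that, assumption+)
    obtain B d where B: "right_average (opposite G) B"
      "\<And>x. x \<in> carrier G \<Longrightarrow> \<bar>B v x - d\<bar> \<le> \<epsilon> / 4"
      by (rule opp.almost_periodic_flatten[OF almost_periodic_opposite[OF assms] \<epsilon>, unfolded opposite_simps]) (rule that, assumption+)
    have bounds: "c - \<epsilon> / 4 \<le> A v x" "A v x \<le> c + \<epsilon> / 4" "B v x \<le> d + \<epsilon> / 4" "d - \<epsilon> / 4 \<le> B v x"
      if "x \<in> carrier G" for x
      using A(2)[OF that] B(2)[OF that] unfolding abs_le_iff by linarith+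
    have "c - \<epsilon> / 4 \<in> L" unfolding L_def using A(1) bounds by blast
    moreover have "bdd_above L"
      using upper[OF _ B(1)] bounds(3) by (auto simp: bdd_above_def)
    ultimately have "c - \<epsilon> / 4 \<le> Sup L" by (rule cSup_upper)
    moreover have "Sup L \<le> d + \<epsilon> / 4"
      using \<open>c - \<epsilon> / 4 \<in> L\<close> upper[OF _ B(1)] bounds(3) by (intro cSup_least) auto
    moreover have "d - \<epsilon> / 4 \<le> c + \<epsilon> / 4"
      using opp.right_mean_cross[of B A "d - \<epsilon> / 4" v v "c + \<epsilon> / 4"] A(1) B(1) bounds by simp
    ultimately have "Sup L - \<epsilon> \<le> A v x \<and> A v x \<le> Sup L + \<epsilon>" if "x \<in> carrier G" for x
      using bounds[OF that] \<open>\<epsilon> > 0\<close> by linarith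
    with A(1) show "\<exists>A. right_average G A \<and> (\<forall>x\<in>carrier G. Sup L - \<epsilon> \<le> A v x \<and> A v x \<le> Sup L + \<epsilon>)"
      by blast
  qed
qed

definition ap_mean :: "('a \<Rightarrow> real) \<Rightarrow> real" where
  "ap_mean v = (THE c. right_mean G v c)"

lemma ap_mean:
  assumes "almost_periodic G v"
  shows "right_mean G v (ap_mean v)" "right_mean (opposite G) v (ap_mean v)"
proof -
  interpret opp: group "opposite G" by (rule group_opposite)
  obtain c where c: "right_mean G v c" using almost_periodic_right_mean[OF assms] .
  obtain d where d: "right_mean (opposite G) v d"
    using opp.almost_periodic_right_mean[OF almost_periodic_opposite[OF assms]] .
  have "ap_mean v = c"
    unfolding ap_mean_def using c right_left_mean_eq[OF _ d] by (intro the_equality) auto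
  then show "right_mean G v (ap_mean v)" "right_mean (opposite G) v (ap_mean v)"
    using c d right_left_mean_eq[OF c d] by simp_all
qed

lemma ap_mean_eqI:
  assumes "almost_periodic G v" "right_mean G v c"
  shows "ap_mean v = c"
  using right_left_mean_eq[OF assms(2) ap_mean(2)[OF assms(1)]] by simp

lemma ap_mean_mono:
  assumes "almost_periodic G v" "almost_periodic G w" "\<And>x. x \<in> carrier G \<Longrightarrow> v x \<le> w x"
  shows "ap_mean v \<le> ap_mean w"
  using right_left_mean_mono[OF ap_mean(1)[OF assms(1)] ap_mean(2)[OF assms(2)] assms(3)] .

lemma almost_periodic_const: "almost_periodic G (\<lambda>x. c)"
  unfolding almost_periodic_def by (auto intro!: exI[of _ "{\<one>}"])

lemma ap_mean_const: "ap_mean (\<lambda>x. c) = c"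
proof (rule ap_mean_eqI[OF almost_periodic_const right_meanI])
  show "\<exists>A. right_average G A \<and> (\<forall>x\<in>carrier G. c - \<epsilon> \<le> A (\<lambda>x. c) x \<and> A (\<lambda>x. c) x \<le> c + \<epsilon>)"
    if "\<epsilon> > 0" for \<epsilon>
    using that by (intro exI[of _ "\<lambda>v. v"] conjI right_average.id) simp
qed

text \<open>A left average that brings \<open>v\<close> within \<epsilon> of its mean does the same
  for \<open>A v\<close>, because \<open>A\<close> keeps \<open>B v\<close> in the same interval and
  commutes with \<open>B\<close>.\<close>

lemma ap_mean_right_average:
  assumes v: "almost_periodic G v" and A: "right_average G A"
  shows "ap_mean (A v) = ap_mean v"
proof -
  interpret opp: group "opposite G" by (rule group_opposite)
  have "right_mean (opposite G) (A v) (ap_mean v)"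
  proof (rule opp.right_meanI)
    fix \<epsilon> :: real assume "\<epsilon> > 0"
    obtain B where B: "right_average (opposite G) B"
      "\<And>x. x \<in> carrier G \<Longrightarrow> B v x \<le> ap_mean v + \<epsilon>" "\<And>x. x \<in> carrier G \<Longrightarrow> ap_mean v - \<epsilon> \<le> B v x"
      by (rule opp.right_meanD[OF ap_mean(2)[OF v] \<open>\<epsilon> > 0\<close>, unfolded opposite_simps]) (rule that, assumption+)
    have "ap_mean v - \<epsilon> \<le> A (B v) x \<and> A (B v) x \<le> ap_mean v + \<epsilon>" if "x \<in> carrier G" for x
      using right_average_mono[OF A, of "B v" "\<lambda>x. ap_mean v + \<epsilon>" x]
        right_average_mono[OF A, of "\<lambda>x. ap_mean v - \<epsilon>" "B v" x] B(2,3) that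
      by (simp add: right_average_const[OF A])
    then show "\<exists>B. right_average (opposite G) B \<and>
        (\<forall>x\<in>carrier (opposite G). ap_mean v - \<epsilon> \<le> B (A v) x \<and> B (A v) x \<le> ap_mean v + \<epsilon>)"
      using B(1) by (intro exI[of _ B]) (simp add: right_left_average_commute[OF A B(1)])
  qed
  then show ?thesis
    using right_left_mean_eq[OF ap_mean(1)[OF almost_periodic_right_average[OF v A]]] by simp
qed

text \<open>An average that flattens \<open>v\<close> may leave \<open>w\<close> rough. So
  \<open>A\<close> flattens \<open>v\<close>, and then \<open>B\<close> flattens \<open>A w\<close>,
  whose mean is still that of \<open>w\<close>; \<open>B\<close> cannot spoil the bounds already
  reached for \<open>A v\<close>.\<close>

lemma ap_mean_add:
  assumes v: "almost_periodic G v" and w: "almost_periodic G w"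
    and vw: "almost_periodic G (\<lambda>x. v x + w x)"
  shows "ap_mean (\<lambda>x. v x + w x) = ap_mean v + ap_mean w"
proof (rule ap_mean_eqI[OF vw right_meanI])
  fix \<epsilon> :: real assume "\<epsilon> > 0"
  then have \<epsilon>: "\<epsilon> / 2 > 0" by simp
  obtain A where A: "right_average G A"
    "\<And>x. x \<in> carrier G \<Longrightarrow> A v x \<le> ap_mean v + \<epsilon> / 2" "\<And>x. x \<in> carrier G \<Longrightarrow> ap_mean v - \<epsilon> / 2 \<le> A v x"
    by (rule right_meanD[OF ap_mean(1)[OF v] \<epsilon>]) (rule that, assumption+)
  have "right_mean G (A w) (ap_mean w)"
    using ap_mean(1)[OF almost_periodic_right_average[OF w A(1)]] ap_mean_right_average[OF w A(1)] by simp
  from right_meanD[OF this \<epsilon>] obtain B where B: "right_average G B"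
    "\<And>x. x \<in> carrier G \<Longrightarrow> B (A w) x \<le> ap_mean w + \<epsilon> / 2"
    "\<And>x. x \<in> carrier G \<Longrightarrow> ap_mean w - \<epsilon> / 2 \<le> B (A w) x"
    by blast
  have "ap_mean v + ap_mean w - \<epsilon> \<le> B (A (\<lambda>x. v x + w x)) x \<and>
      B (A (\<lambda>x. v x + w x)) x \<le> ap_mean v + ap_mean w + \<epsilon>" if x: "x \<in> carrier G" for x
  proof -
    have "B (A (\<lambda>x. v x + w x)) x = B (\<lambda>x. A v x + A w x) x"
      by (rule right_average_cong[OF B(1) _ x]) (rule right_average_add[OF A(1)])
    also have "\<dots> = B (A v) x + B (A w) x" by (rule right_average_add[OF B(1)])
    finally have "B (A (\<lambda>x. v x + w x)) x = B (A v) x + B (A w) x" .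
    moreover have "B (A v) x \<le> B (\<lambda>x. ap_mean v + \<epsilon> / 2) x"
      by (rule right_average_mono[OF B(1) A(2) x])
    moreover have "B (\<lambda>x. ap_mean v - \<epsilon> / 2) x \<le> B (A v) x"
      by (rule right_average_mono[OF B(1) A(3) x])
    ultimately show ?thesis
      using B(2,3)[OF x] unfolding right_average_const[OF B(1)] by linarith
  qed
  then show "\<exists>A. right_average G A \<and> (\<forall>x\<in>carrier G.
      ap_mean v + ap_mean w - \<epsilon> \<le> A (\<lambda>x. v x + w x) x \<and> A (\<lambda>x. v x + w x) x \<le> ap_mean v + ap_mean w + \<epsilon>)"
    using right_average_compose[OF B(1) A(1)] by (intro exI[of _ "\<lambda>v. B (A v)"]) simp
qed

text \<open>Left averages commute with right translation, so one \<open>B\<close> brings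
  \<open>v\<close> and its translate close to the same constant.\<close>

lemma ap_mean_right_translate:
  assumes v: "almost_periodic G v" and g: "g \<in> carrier G"
    and vg: "almost_periodic G (\<lambda>x. v (x \<otimes> g))"
  shows "ap_mean (\<lambda>x. v (x \<otimes> g)) = ap_mean v"
proof -
  interpret opp: group "opposite G" by (rule group_opposite)
  have "right_mean (opposite G) (\<lambda>x. v (x \<otimes> g)) (ap_mean v)"
  proof (rule opp.right_meanI)
    fix \<epsilon> :: real assume "\<epsilon> > 0"
    obtain B where B: "right_average (opposite G) B"
      "\<And>x. x \<in> carrier G \<Longrightarrow> B v x \<le> ap_mean v + \<epsilon>" "\<And>x. x \<in> carrier G \<Longrightarrow> ap_mean v - \<epsilon> \<le> B v x"
      by (rule opp.right_meanD[OF ap_mean(2)[OF v] \<open>\<epsilon> > 0\<close>, unfolded opposite_simps]) (rule that, assumption+)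
    have "B (\<lambda>x. v (x \<otimes> g)) x = B v (x \<otimes> g)" if "x \<in> carrier G" for x
      using opp.right_average_translate[OF B(1), of g x v] g that by simp
    then show "\<exists>B. right_average (opposite G) B \<and>
        (\<forall>x\<in>carrier (opposite G). ap_mean v - \<epsilon> \<le> B (\<lambda>x. v (x \<otimes> g)) x \<and> B (\<lambda>x. v (x \<otimes> g)) x \<le> ap_mean v + \<epsilon>)"
      using B g by (intro exI[of _ B]) simp
  qed
  then show ?thesis using right_left_mean_eq[OF ap_mean(1)[OF vg]] by simp
qed

end

section \<open>Radon measures from positive functionals\<close>

text \<open>The content of an open set in the Riesz construction. Test functions only vanish off
  \<open>U\<close>; compact support inside \<open>U\<close> is recovered by
  \<open>content_least_cutoff\<close>.\<close>

definition functional_content :: "'a topology \<Rightarrow> (('a \<Rightarrow> real) \<Rightarrow> real) \<Rightarrow> 'a set \<Rightarrow> ennreal" where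
  "functional_content T \<Lambda> U = (SUP f\<in>{f. continuous_map T euclideanreal f \<and>
     (\<forall>x\<in>topspace T. 0 \<le> f x \<and> f x \<le> 1) \<and> (\<forall>x\<in>topspace T - U. f x = 0)}. ennreal (\<Lambda> f))"

definition functional_outer :: "'a topology \<Rightarrow> (('a \<Rightarrow> real) \<Rightarrow> real) \<Rightarrow> 'a set \<Rightarrow> ennreal" where
  "functional_outer T \<Lambda> E = (INF U\<in>{U. openin T U \<and> E \<subseteq> U}. functional_content T \<Lambda> U)"

text \<open>Additivity is confined to nonnegative functions and there is no homogeneity, because
  that is the form in which \<open>haar\<close> delivers it. \<open>const_le\<close> is the
  quantitative substitute behind the cutoff argument.\<close>

locale positive_functional =
  fixes T :: "'a topology" and \<Lambda> :: "('a \<Rightarrow> real) \<Rightarrow> real" and C :: real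
  assumes compact: "compact_space T" and Hausdorff: "Hausdorff_space T"
    and nonneg: "\<And>f. continuous_map T euclideanreal f \<Longrightarrow> (\<And>x. x \<in> topspace T \<Longrightarrow> 0 \<le> f x) \<Longrightarrow> 0 \<le> \<Lambda> f"
    and add: "\<And>f g. continuous_map T euclideanreal f \<Longrightarrow> (\<And>x. x \<in> topspace T \<Longrightarrow> 0 \<le> f x) \<Longrightarrow>
       continuous_map T euclideanreal g \<Longrightarrow> (\<And>x. x \<in> topspace T \<Longrightarrow> 0 \<le> g x) \<Longrightarrow>
       \<Lambda> (\<lambda>x. f x + g x) = \<Lambda> f + \<Lambda> g"
    and const_le: "\<And>\<delta>. 0 \<le> \<delta> \<Longrightarrow> \<Lambda> (\<lambda>x. \<delta>) \<le> C * \<delta>"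
begin

lemma mono:
  assumes "continuous_map T euclideanreal f" "continuous_map T euclideanreal g"
    "\<And>x. x \<in> topspace T \<Longrightarrow> 0 \<le> f x" "\<And>x. x \<in> topspace T \<Longrightarrow> f x \<le> g x"
  shows "\<Lambda> f \<le> \<Lambda> g"
proof -
  have cont: "continuous_map T euclideanreal (\<lambda>x. g x - f x)"
    using assms by (intro continuous_map_diff)
  have "\<Lambda> (\<lambda>x. f x + (g x - f x)) = \<Lambda> f + \<Lambda> (\<lambda>x. g x - f x)"
    using assms cont by (intro add) auto
  moreover have "0 \<le> \<Lambda> (\<lambda>x. g x - f x)" using assms cont by (intro nonneg) auto
  ultimately show ?thesis by simp
qed

lemma C_nonneg: "0 \<le> C"
  using nonneg[of "\<lambda>x. 1"] const_le[of 1] by simp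

lemma contentI:
  assumes "continuous_map T euclideanreal f" "\<And>x. x \<in> topspace T \<Longrightarrow> 0 \<le> f x"
    "\<And>x. x \<in> topspace T \<Longrightarrow> f x \<le> 1" "\<And>x. x \<in> topspace T \<Longrightarrow> x \<notin> U \<Longrightarrow> f x = 0"
  shows "ennreal (\<Lambda> f) \<le> functional_content T \<Lambda> U"
  unfolding functional_content_def using assms by (intro SUP_upper) auto

lemma content_least:
  assumes "\<And>f. continuous_map T euclideanreal f \<Longrightarrow> (\<And>x. x \<in> topspace T \<Longrightarrow> 0 \<le> f x) \<Longrightarrow>
    (\<And>x. x \<in> topspace T \<Longrightarrow> f x \<le> 1) \<Longrightarrow> (\<And>x. x \<in> topspace T \<Longrightarrow> x \<notin> U \<Longrightarrow> f x = 0) \<Longrightarrow>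
    ennreal (\<Lambda> f) \<le> b"
  shows "functional_content T \<Lambda> U \<le> b"
  unfolding functional_content_def using assms by (intro SUP_least) auto

text \<open>Cutting \<open>f\<close> off at a small height \<open>\<delta>\<close> replaces its support by the compact set
  \<open>{f \<ge> \<delta>}\<close> at a cost of at most \<open>C \<delta>\<close>.\<close>

lemma content_least_cutoff:
  assumes "\<And>f \<delta>. continuous_map T euclideanreal f \<Longrightarrow> (\<And>x. x \<in> topspace T \<Longrightarrow> 0 \<le> f x) \<Longrightarrow>
    (\<And>x. x \<in> topspace T \<Longrightarrow> f x \<le> 1) \<Longrightarrow> (\<And>x. x \<in> topspace T \<Longrightarrow> x \<notin> U \<Longrightarrow> f x = 0) \<Longrightarrow>
    \<delta> > 0 \<Longrightarrow> ennreal (\<Lambda> (\<lambda>x. max 0 (f x - \<delta>))) \<le> b"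
  shows "functional_content T \<Lambda> U \<le> b"
proof (rule content_least)
  fix f assume f: "continuous_map T euclideanreal f" "\<And>x. x \<in> topspace T \<Longrightarrow> 0 \<le> f x"
    "\<And>x. x \<in> topspace T \<Longrightarrow> f x \<le> 1" "\<And>x. x \<in> topspace T \<Longrightarrow> x \<notin> U \<Longrightarrow> f x = 0"
  show "ennreal (\<Lambda> f) \<le> b"
  proof (rule ennreal_le_epsilon)
    fix e :: real assume "e > 0"
    \<comment> \<open>\<open>C\<close> may be 0, hence the denominator \<open>C + 1\<close>.\<close>
    define \<delta> where "\<delta> = e / (C + 1)"
    have \<delta>: "\<delta> > 0" "C * \<delta> \<le> e"
      using \<open>e > 0\<close> C_nonneg by (auto simp: \<delta>_def field_simps)
    have cont: "continuous_map T euclideanreal (\<lambda>x. max 0 (f x - \<delta>))"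
      using f by (intro continuous_intros) auto
    have "\<Lambda> f \<le> \<Lambda> (\<lambda>x. max 0 (f x - \<delta>) + \<delta>)"
      using f cont by (intro mono continuous_map_add) auto
    also have "\<dots> = \<Lambda> (\<lambda>x. max 0 (f x - \<delta>)) + \<Lambda> (\<lambda>x. \<delta>)"
      using cont \<delta> by (intro add) auto
    also have "\<dots> \<le> \<Lambda> (\<lambda>x. max 0 (f x - \<delta>)) + e"
      using const_le[of \<delta>] \<delta> by simp
    finally have "ennreal (\<Lambda> f) \<le> ennreal (\<Lambda> (\<lambda>x. max 0 (f x - \<delta>)) + e)"
      by (rule ennreal_leI)
    also have "\<dots> = ennreal (\<Lambda> (\<lambda>x. max 0 (f x - \<delta>))) + ennreal e"
      using \<open>e > 0\<close> nonneg[OF cont] by (intro ennreal_plus) auto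
    also have "\<dots> \<le> b + ennreal e"
      using f \<delta> by (intro add_right_mono assms) auto
    finally show "ennreal (\<Lambda> f) \<le> b + ennreal e" .
  qed
qed

section \<open>Subadditivity of the content\<close>

lemma content_mono: "U \<subseteq> V \<Longrightarrow> functional_content T \<Lambda> U \<le> functional_content T \<Lambda> V"
  by (rule content_least, rule contentI) auto

lemma content_empty: "functional_content T \<Lambda> {} = 0"
proof -
  have "functional_content T \<Lambda> {} \<le> 0"
  proof (rule content_least)
    fix f assume f: "continuous_map T euclideanreal f"  "\<And>x. x \<in> topspace T \<Longrightarrow> x \<notin> {} \<Longrightarrow> f x = 0"
    then have "\<Lambda> f \<le> \<Lambda> (\<lambda>x. 0)" by (intro mono) auto
    also have "\<dots> \<le> 0" using const_le[of 0] by simp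
    finally show "ennreal (\<Lambda> f) \<le> 0" by (simp add: ennreal_neg)
  qed
  then show ?thesis by simp
qed

lemma content_topspace: "functional_content T \<Lambda> (topspace T) = ennreal (\<Lambda> (\<lambda>x. 1))"
  by (intro antisym content_least contentI ennreal_leI mono) auto

lemma content_finite: "functional_content T \<Lambda> U < \<infinity>"
proof -
  have "functional_content T \<Lambda> U \<le> ennreal (\<Lambda> (\<lambda>x. 1))"
    by (intro content_least ennreal_leI mono) auto
  then show ?thesis by (simp add: order_le_less_trans)
qed

lemma closedin_superlevel:
  assumes "continuous_map T euclideanreal f"
  shows "closedin T {x \<in> topspace T. \<delta> \<le> f x}"
  using closedin_continuous_map_preimage[OF assms, of "{\<delta>..}"] by simp

text \<open>A Urysohn function that is 0 off \<open>U\<close> and 1 on the part of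
  \<open>{f \<ge> \<delta>}\<close> outside \<open>V\<close> splits the truncated \<open>f\<close>
  into a summand vanishing off \<open>U\<close> and one vanishing off \<open>V\<close>. Truncation
  is what makes the two sets closed and disjoint.\<close>

lemma content_Un:
  assumes "openin T U" "openin T V"
  shows "functional_content T \<Lambda> (U \<union> V) \<le> functional_content T \<Lambda> U + functional_content T \<Lambda> V"
proof (rule content_least_cutoff)
  fix f :: "'a \<Rightarrow> real" and \<delta> :: real assume f: "continuous_map T euclideanreal f" "\<And>x. x \<in> topspace T \<Longrightarrow> 0 \<le> f x"
    "\<And>x. x \<in> topspace T \<Longrightarrow> f x \<le> 1" "\<And>x. x \<in> topspace T \<Longrightarrow> x \<notin> U \<union> V \<Longrightarrow> f x = 0" and "\<delta> > 0"
  have normal: "normal_space T"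
    using compact Hausdorff by (intro compact_Hausdorff_or_regular_imp_normal_space) auto
  let ?K = "{x \<in> topspace T. \<delta> \<le> f x}"
  have "closedin T (topspace T - U)" "closedin T (?K - V)"
    using assms closedin_superlevel[OF f(1)] by (auto intro: closedin_diff)
  moreover have "disjnt (topspace T - U) (?K - V)"
    using f(4) \<open>\<delta> > 0\<close> by (force simp: disjnt_def)
  ultimately obtain \<phi> where \<phi>: "continuous_map T (top_of_set {0..1::real}) \<phi>"
      "\<phi> ` (topspace T - U) \<subseteq> {0}" "\<phi> ` (?K - V) \<subseteq> {1}"
    by (rule Urysohn_lemma[OF normal _ _ _ zero_le_one])
  have \<phi>_cont: "continuous_map T euclideanreal \<phi>" and \<phi>_range: "\<And>x. x \<in> topspace T \<Longrightarrow> 0 \<le> \<phi> x \<and> \<phi> x \<le> 1"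
    using \<phi>(1) by (auto simp: continuous_map_in_subtopology image_subset_iff)
  let ?h = "\<lambda>x. max 0 (f x - \<delta>)"
  have h: "continuous_map T euclideanreal ?h" using f by (intro continuous_intros) auto
  let ?f1 = "\<lambda>x. ?h x * \<phi> x" and ?f2 = "\<lambda>x. ?h x * (1 - \<phi> x)"
  have f12: "continuous_map T euclideanreal ?f1" "continuous_map T euclideanreal ?f2"
    using h \<phi>_cont by (intro continuous_map_real_mult continuous_map_diff; auto)+
  have h1: "?h x \<le> 1" if "x \<in> topspace T" for x using f(3)[OF that] \<open>\<delta> > 0\<close> by simp
  have "\<Lambda> ?h = \<Lambda> (\<lambda>x. ?f1 x + ?f2 x)" by (rule arg_cong[of _ _ \<Lambda>]) (auto simp: algebra_simps)
  also have "\<dots> = \<Lambda> ?f1 + \<Lambda> ?f2" using f12 \<phi>_range by (intro add) auto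
  finally have "ennreal (\<Lambda> ?h) = ennreal (\<Lambda> ?f1) + ennreal (\<Lambda> ?f2)"
    using f12 \<phi>_range nonneg by (simp add: ennreal_plus)
  also have "\<dots> \<le> functional_content T \<Lambda> U + functional_content T \<Lambda> V"
  proof (intro add_mono contentI f12)
    fix x assume x: "x \<in> topspace T"
    show "0 \<le> ?f1 x" "0 \<le> ?f2 x" using \<phi>_range[OF x] by auto
    show "?f1 x \<le> 1" "?f2 x \<le> 1" using \<phi>_range[OF x] h1[OF x] by (auto intro!: mult_le_one)
    show "?f1 x = 0" if "x \<notin> U" using \<phi>(2) x that by auto
    show "?f2 x = 0" if "x \<notin> V"
    proof (cases "\<delta> \<le> f x")
      case True
      then show ?thesis using \<phi>(3) x that by auto
    qed simp
  qed
  finally show "ennreal (\<Lambda> ?h) \<le> functional_content T \<Lambda> U + functional_content T \<Lambda> V" .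
qed

lemma content_UN_lessThan:
  assumes "\<And>i::nat. openin T (U i)"
  shows "functional_content T \<Lambda> (\<Union>i<n. U i) \<le> (\<Sum>i<n. functional_content T \<Lambda> (U i))"
proof (induction n)
  case (Suc n)
  have "functional_content T \<Lambda> (\<Union>i<Suc n. U i) = functional_content T \<Lambda> ((\<Union>i<n. U i) \<union> U n)"
    by (simp add: lessThan_Suc Un_commute)
  also have "\<dots> \<le> functional_content T \<Lambda> (\<Union>i<n. U i) + functional_content T \<Lambda> (U n)"
    using assms by (intro content_Un) auto
  also have "\<dots> \<le> (\<Sum>i<Suc n. functional_content T \<Lambda> (U i))"
    using Suc by (simp add: add_right_mono)
  finally show ?case .
qed (simp add: content_empty)

text \<open>After truncation only the compact set \<open>{f \<ge> \<delta>}\<close> matters, and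
  finitely many \<open>U i\<close> cover it.\<close>

lemma content_UN:
  assumes U: "\<And>i::nat. openin T (U i)"
  shows "functional_content T \<Lambda> (\<Union>i. U i) \<le> (\<Sum>i. functional_content T \<Lambda> (U i))"
proof (rule content_least_cutoff)
  fix f :: "'a \<Rightarrow> real" and \<delta> :: real assume f: "continuous_map T euclideanreal f" "\<And>x. x \<in> topspace T \<Longrightarrow> 0 \<le> f x"
    "\<And>x. x \<in> topspace T \<Longrightarrow> f x \<le> 1" "\<And>x. x \<in> topspace T \<Longrightarrow> x \<notin> (\<Union>i. U i) \<Longrightarrow> f x = 0" and "\<delta> > 0"
  let ?K = "{x \<in> topspace T. \<delta> \<le> f x}"
  have "compactin T ?K"
    by (rule closedin_compact_space[OF compact closedin_superlevel[OF f(1)]])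
  moreover have "?K \<subseteq> \<Union> (range U)" using f(4) \<open>\<delta> > 0\<close> by force
  ultimately have "\<exists>\<F>. finite \<F> \<and> \<F> \<subseteq> range U \<and> ?K \<subseteq> \<Union>\<F>"
    using U by (intro compactinD) auto
  then obtain \<F> where \<F>: "finite \<F>" "\<F> \<subseteq> range U" "?K \<subseteq> \<Union>\<F>" by blast
  then obtain I where I: "finite I" "\<F> = U ` I"
    using finite_subset_image[of \<F> U UNIV] by blast
  then obtain n where "I \<subseteq> {..<n}"
    using finite_nat_iff_bounded by blast
  then have K: "?K \<subseteq> (\<Union>i<n. U i)" using \<F>(3) I(2) by blast
  have "ennreal (\<Lambda> (\<lambda>x. max 0 (f x - \<delta>))) \<le> functional_content T \<Lambda> (\<Union>i<n. U i)"
  proof (rule contentI)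
    show "continuous_map T euclideanreal (\<lambda>x. max 0 (f x - \<delta>))"
      using f by (intro continuous_intros) auto
    fix x assume "x \<in> topspace T"
    then show "max 0 (f x - \<delta>) \<le> 1" using f(3)[of x] \<open>\<delta> > 0\<close> by simp
    show "max 0 (f x - \<delta>) = 0" if "x \<notin> (\<Union>i<n. U i)"
      using K that \<open>x \<in> topspace T\<close> by (force simp: max_def)
  qed simp
  also have "\<dots> \<le> (\<Sum>i<n. functional_content T \<Lambda> (U i))" using U by (rule content_UN_lessThan)
  also have "\<dots> \<le> (\<Sum>i. functional_content T \<Lambda> (U i))" by (rule sum_le_suminf) auto
  finally show "ennreal (\<Lambda> (\<lambda>x. max 0 (f x - \<delta>))) \<le> (\<Sum>i. functional_content T \<Lambda> (U i))" .
qed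

section \<open>The outer measure, its measurable sets and the Radon measure\<close>

lemma outer_le: "openin T U \<Longrightarrow> E \<subseteq> U \<Longrightarrow> functional_outer T \<Lambda> E \<le> functional_content T \<Lambda> U"
  unfolding functional_outer_def by (intro INF_lower) auto

lemma outer_open: "openin T U \<Longrightarrow> functional_outer T \<Lambda> U = functional_content T \<Lambda> U"
  by (intro antisym outer_le) (auto simp: functional_outer_def intro!: INF_greatest content_mono)

lemma outer_less:
  assumes "functional_outer T \<Lambda> E < b"
  obtains U where "openin T U" "E \<subseteq> U" "functional_content T \<Lambda> U < b"
  using assms unfolding functional_outer_def INF_less_iff by auto

lemma outer_finite: "E \<subseteq> topspace T \<Longrightarrow> functional_outer T \<Lambda> E < \<infinity>"
  by (rule order_le_less_trans[OF outer_le content_finite]) auto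

lemma outer_mono: "E \<subseteq> F \<Longrightarrow> functional_outer T \<Lambda> E \<le> functional_outer T \<Lambda> F"
  unfolding functional_outer_def by (intro INF_superset_mono) auto

lemma outer_measure_space_outer: "outer_measure_space (Pow (topspace T)) (functional_outer T \<Lambda>)"
  unfolding outer_measure_space_def
proof (intro conjI)
  show "positive (Pow (topspace T)) (functional_outer T \<Lambda>)"
    by (simp add: positive_def outer_open content_empty)
  show "increasing (Pow (topspace T)) (functional_outer T \<Lambda>)"
    by (simp add: increasing_def outer_mono)
  show "countably_subadditive (Pow (topspace T)) (functional_outer T \<Lambda>)"
    unfolding countably_subadditive_def
  proof (intro allI impI)
    fix A :: "nat \<Rightarrow> 'a set" assume A: "range A \<subseteq> Pow (topspace T)"
    show "functional_outer T \<Lambda> (\<Union>i. A i) \<le> (\<Sum>i. functional_outer T \<Lambda> (A i))"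
    proof (rule ennreal_le_epsilon)
      fix e :: real assume "e > 0"
      have "\<exists>U. openin T U \<and> A i \<subseteq> U \<and>
          functional_content T \<Lambda> U < functional_outer T \<Lambda> (A i) + e * (1/2) ^ Suc i" for i
      proof -
        have "functional_outer T \<Lambda> (A i) < functional_outer T \<Lambda> (A i) + e * (1/2) ^ Suc i"
          using outer_finite[of "A i"] A \<open>e > 0\<close> by (auto simp: ennreal_zero_less_mult_iff less_top)
        then show ?thesis by (metis outer_less)
      qed
      then obtain U where U: "\<And>i. openin T (U i)" "\<And>i. A i \<subseteq> U i"
        "\<And>i. functional_content T \<Lambda> (U i) < functional_outer T \<Lambda> (A i) + e * (1/2) ^ Suc i" by metis
      have "functional_outer T \<Lambda> (\<Union>i. A i) \<le> functional_content T \<Lambda> (\<Union>i. U i)"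
        using U by (intro outer_le) auto
      also have "\<dots> \<le> (\<Sum>i. functional_content T \<Lambda> (U i))" by (rule content_UN) (rule U)
      also have "\<dots> \<le> (\<Sum>i. functional_outer T \<Lambda> (A i) + e * (1/2) ^ Suc i)"
        using U(3) by (intro suminf_le) (auto intro: less_imp_le)
      also have "\<dots> = (\<Sum>i. functional_outer T \<Lambda> (A i)) + (\<Sum>i. ennreal (e * (1/2) ^ Suc i))"
        by (rule suminf_add[symmetric]) auto
      also have "(\<Sum>i. ennreal (e * (1/2) ^ Suc i)) = ennreal e"
        using \<open>e > 0\<close> power_half_series[THEN sums_mult, of e]
        by (intro suminf_ennreal_eq) auto
      finally show "functional_outer T \<Lambda> (\<Union>i. A i) \<le> (\<Sum>i. functional_outer T \<Lambda> (A i)) + ennreal e" .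
    qed
  qed
qed

text \<open>A test function for \<open>U \<inter> V\<close> is truncated to \<open>?h\<close>, which
  vanishes off \<open>?K\<close>, and \<open>g\<close> is a test function for \<open>U - ?K\<close>.
  At each point at most one of them is non-zero, so \<open>g + ?h\<close> stays below 1 and competes
  for the content of \<open>U\<close>. Suprema over \<open>g\<close> and \<open>f\<close> give the
  claim.\<close>

lemma outer_split_open:
  assumes U: "openin T U" and V: "openin T V"
  shows "functional_content T \<Lambda> (U \<inter> V) + functional_outer T \<Lambda> (U - V) \<le> functional_content T \<Lambda> U"
proof -
  let ?c = "functional_content T \<Lambda> U" and ?o = "functional_outer T \<Lambda> (U - V)"
  have o: "?o \<le> ?c" using U by (intro outer_le) auto
  have "functional_content T \<Lambda> (U \<inter> V) \<le> ?c - ?o"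
  proof (rule content_least_cutoff)
    fix f :: "'a \<Rightarrow> real" and \<delta> :: real assume f: "continuous_map T euclideanreal f" "\<And>x. x \<in> topspace T \<Longrightarrow> 0 \<le> f x"
      "\<And>x. x \<in> topspace T \<Longrightarrow> f x \<le> 1" "\<And>x. x \<in> topspace T \<Longrightarrow> x \<notin> U \<inter> V \<Longrightarrow> f x = 0" and "\<delta> > 0"
    let ?K = "{x \<in> topspace T. \<delta> \<le> f x}" and ?h = "\<lambda>x. max 0 (f x - \<delta>)"
    have h: "continuous_map T euclideanreal ?h" using f by (intro continuous_intros) auto
    have "\<Lambda> ?h \<ge> 0" using h by (rule nonneg) auto
    have "?o \<le> functional_content T \<Lambda> (U - ?K)"
    proof (rule outer_le)
      show "openin T (U - ?K)" using U closedin_superlevel[OF f(1)] by (rule openin_diff)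
      show "U - V \<subseteq> U - ?K" using f(4) \<open>\<delta> > 0\<close> by force
    qed
    also have "\<dots> \<le> ?c - ennreal (\<Lambda> ?h)"
    proof (rule content_least)
      fix g assume g: "continuous_map T euclideanreal g" "\<And>x. x \<in> topspace T \<Longrightarrow> 0 \<le> g x"
        "\<And>x. x \<in> topspace T \<Longrightarrow> g x \<le> 1" "\<And>x. x \<in> topspace T \<Longrightarrow> x \<notin> U - ?K \<Longrightarrow> g x = 0"
      have "ennreal (\<Lambda> (\<lambda>x. g x + ?h x)) \<le> ?c"
      proof (rule contentI)
        show "continuous_map T euclideanreal (\<lambda>x. g x + ?h x)" using g(1) h by (rule continuous_map_add)
        fix x assume x: "x \<in> topspace T"
        show "0 \<le> g x + ?h x" using g(2)[OF x] by simp
        show "g x + ?h x \<le> 1"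
          using f(3)[OF x] g(3,4)[OF x] x \<open>\<delta> > 0\<close> by (cases "\<delta> \<le> f x") auto
        show "g x + ?h x = 0" if "x \<notin> U" using g(4)[OF x] f(4)[OF x] that \<open>\<delta> > 0\<close> by auto
      qed
      also have "\<Lambda> (\<lambda>x. g x + ?h x) = \<Lambda> g + \<Lambda> ?h"
        using g h by (intro add) auto
      finally have "ennreal (\<Lambda> g) + ennreal (\<Lambda> ?h) \<le> ?c"
        using \<open>\<Lambda> ?h \<ge> 0\<close> nonneg[OF g(1,2)] by (simp add: ennreal_plus)
      then show "ennreal (\<Lambda> g) \<le> ?c - ennreal (\<Lambda> ?h)"
        by (simp add: ennreal_le_minus_iff)
    qed
    finally have "?o + ennreal (\<Lambda> ?h) \<le> ?c - ennreal (\<Lambda> ?h) + ennreal (\<Lambda> ?h)"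
      by (rule add_right_mono)
    also have "?c - ennreal (\<Lambda> ?h) + ennreal (\<Lambda> ?h) = ?c"
    proof (rule diff_add_cancel_ennreal, rule contentI[OF h])
      fix x assume x: "x \<in> topspace T"
      show "?h x \<le> 1" using f(3)[OF x] \<open>\<delta> > 0\<close> by simp
      show "?h x = 0" if "x \<notin> U" using f(4)[OF x] that \<open>\<delta> > 0\<close> by simp
    qed simp
    finally show "ennreal (\<Lambda> ?h) \<le> ?c - ?o" by (simp add: ennreal_le_minus_iff add.commute)
  qed
  then have "functional_content T \<Lambda> (U \<inter> V) + ?o \<le> ?c - ?o + ?o" by (rule add_right_mono)
  also have "\<dots> = ?c" using o by (rule diff_add_cancel_ennreal)
  finally show ?thesis .
qed

text \<open>The nontrivial half of the Caratheodory condition is \<open>outer_split_open\<close> for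
  each open \<open>U\<close> above \<open>E\<close>, followed by the infimum over
  \<open>U\<close>.\<close>

lemma openin_lambda_system:
  assumes V: "openin T V"
  shows "V \<in> lambda_system (topspace T) (Pow (topspace T)) (functional_outer T \<Lambda>)"
  unfolding algebra.lambda_system_eq[OF algebra_Pow]
proof (intro CollectI conjI ballI antisym)
  show "V \<in> Pow (topspace T)" using openin_subset[OF V] by simp
  fix E assume E: "E \<in> Pow (topspace T)"
  show "functional_outer T \<Lambda> (E \<inter> V) + functional_outer T \<Lambda> (E - V) \<le> functional_outer T \<Lambda> E"
    unfolding functional_outer_def[of _ _ E]
  proof (rule INF_greatest)
    fix U assume "U \<in> {U. openin T U \<and> E \<subseteq> U}"
    then have U: "openin T U" "E \<subseteq> U" by auto
    have "functional_outer T \<Lambda> (E \<inter> V) + functional_outer T \<Lambda> (E - V)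
        \<le> functional_content T \<Lambda> (U \<inter> V) + functional_outer T \<Lambda> (U - V)"
      using U V by (intro add_mono outer_le outer_mono) auto
    also have "\<dots> \<le> functional_content T \<Lambda> U" using U(1) V by (rule outer_split_open)
    finally show "functional_outer T \<Lambda> (E \<inter> V) + functional_outer T \<Lambda> (E - V) \<le> functional_content T \<Lambda> U" .
  qed
  have "subadditive (Pow (topspace T)) (functional_outer T \<Lambda>)"
    using outer_measure_space_outer unfolding outer_measure_space_def
    by (intro ring_of_sets.countably_subadditive_subadditive[of "topspace T"])
      (auto intro: ring_of_sets_Pow)
  then have "functional_outer T \<Lambda> ((E \<inter> V) \<union> (E - V)) \<le> functional_outer T \<Lambda> (E \<inter> V) + functional_outer T \<Lambda> (E - V)"
    using E by (intro subadditiveD[where M = "Pow (topspace T)"]) auto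
  then show "functional_outer T \<Lambda> E \<le> functional_outer T \<Lambda> (E \<inter> V) + functional_outer T \<Lambda> (E - V)"
    by (simp add: Un_Diff_Int Int_Diff_Un)
qed

text \<open>The formula by \<open>functional_outer\<close> is exported because it carries invariance
  from \<Lambda> to the measure. Inner regularity at \<open>E\<close> is outer regularity at the
  complement, which is built into \<open>functional_outer\<close>, plus compactness of closed
  sets.\<close>

lemma radon_measure_exists:
  obtains M where "finite_radon_measure T M" "emeasure M (topspace T) = ennreal (\<Lambda> (\<lambda>x. 1))"
    "\<And>E. E \<in> borel_sets T \<Longrightarrow> emeasure M E = functional_outer T \<Lambda> E"
proof -
  let ?o = "functional_outer T \<Lambda>" and ?X = "topspace T"
  let ?L = "lambda_system ?X (Pow ?X) ?o"
  have sub: "{U. openin T U} \<subseteq> Pow ?X" by (auto dest: openin_subset)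
  have sigma: "sigma_algebra ?X (borel_sets T)"
    unfolding borel_sets_def using sub by (rule sigma_algebra_sigma_sets)
  have L: "measure_space ?X ?L ?o"
    by (rule sigma_algebra.caratheodory_lemma[OF sigma_algebra_Pow outer_measure_space_outer])
  then have "sigma_algebra ?X ?L" by (simp add: measure_space_def)
  then have "borel_sets T \<subseteq> ?L"
    unfolding borel_sets_def by (rule sigma_algebra.sigma_sets_subset) (auto intro: openin_lambda_system)
  then have ms: "measure_space ?X (borel_sets T) ?o" by (rule measure_down[OF L sigma])
  define M where "M = measure_of ?X (borel_sets T) ?o"
  have sets: "sets M = borel_sets T" and space: "space M = ?X"
    unfolding M_def using sigma sigma_algebra.sets_measure_of_eq sigma_algebra.space_measure_of_eq by blast+
  have em: "emeasure M E = ?o E" if "E \<in> borel_sets T" for E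
    unfolding M_def using ms that by (intro emeasure_measure_of_sigma) (auto simp: measure_space_def)
  have open_borel: "U \<in> borel_sets T" if "openin T U" for U
    using that by (auto simp: borel_sets_def)
  have top: "emeasure M ?X = ennreal (\<Lambda> (\<lambda>x. 1))"
    using em[OF open_borel] by (simp add: outer_open content_topspace)
  interpret finite_measure M
    by (rule finite_measureI) (simp add: space top)
  have "emeasure M E = (SUP K\<in>{K. compactin T K \<and> K \<subseteq> E}. emeasure M K)" if E: "E \<in> borel_sets T" for E
  proof (rule antisym)
    have "E \<subseteq> ?X" using E sigma_algebra.sigma_sets_eq sets space by (metis sets.sets_into_space)
    show "emeasure M E \<le> (SUP K\<in>{K. compactin T K \<and> K \<subseteq> E}. emeasure M K)"
    proof (rule ennreal_le_epsilon)
      fix e :: real assume "e > 0"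
      have XE: "?X - E \<in> borel_sets T" using E sets space by (metis sets.compl_sets)
      have "?o (?X - E) < emeasure M (?X - E) + e"
        using em[OF XE] outer_finite[of "?X - E"] \<open>e > 0\<close> by (auto simp: less_top)
      then obtain U where U: "openin T U" "?X - E \<subseteq> U" "functional_content T \<Lambda> U < emeasure M (?X - E) + e"
        by (rule outer_less)
      have UM: "emeasure M U < emeasure M (?X - E) + e"
        using U em[OF open_borel] by (simp add: outer_open)
      have K: "compactin T (?X - U)" using U(1) compact by (intro closedin_compact_space) auto
      have [measurable]: "U \<in> sets M" "E \<in> sets M" "?X \<in> sets M"
        using U open_borel E sets by auto
      have "emeasure M E \<le> emeasure M ((?X - U) \<union> (U - (?X - E)))"
        using \<open>E \<subseteq> ?X\<close> by (intro emeasure_mono) auto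
      also have "\<dots> \<le> emeasure M (?X - U) + emeasure M (U - (?X - E))"
        by (intro emeasure_subadditive) auto
      also have "emeasure M (U - (?X - E)) = emeasure M U - emeasure M (?X - E)"
        using U by (intro emeasure_Diff) auto
      also have "\<dots> \<le> e"
        using UM by (simp add: ennreal_minus_le_iff less_imp_le)
      also have "emeasure M (?X - U) \<le> (SUP K\<in>{K. compactin T K \<and> K \<subseteq> E}. emeasure M K)"
        using K U(2) by (intro SUP_upper) auto
      finally show "emeasure M E \<le> (SUP K\<in>{K. compactin T K \<and> K \<subseteq> E}. emeasure M K) + ennreal e"
        by (simp add: add_mono)
    qed
    show "(SUP K\<in>{K. compactin T K \<and> K \<subseteq> E}. emeasure M K) \<le> emeasure M E"
      using E sets by (intro SUP_least emeasure_mono) auto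
  qed
  then have "finite_radon_measure T M"
    unfolding finite_radon_measure_def using sets space finite_measure_axioms by blast
  then show ?thesis using top em by (rule that)
qed

end

section \<open>The invariant functional\<close>

lemma compact_space_bounded_above:
  assumes "compact_space T" "continuous_map T euclideanreal f"
  obtains B where "B > 0" "\<And>x. x \<in> topspace T \<Longrightarrow> f x \<le> B"
proof -
  have "compact (f ` topspace T)"
    using image_compactin[of T "topspace T" euclideanreal f] assms by (simp add: compact_space_def)
  then obtain B where "\<And>x. x \<in> topspace T \<Longrightarrow> \<bar>f x\<bar> \<le> B"
    using compact_imp_bounded by (force simp: bounded_iff)
  then show ?thesis by (intro that[of "max 1 B"]) (auto simp: abs_le_iff le_max_iff_disj)
qed

lemma compact_space_finite_nbhds:
  assumes "compact_space T" "\<And>x. x \<in> topspace T \<Longrightarrow> openin T (N x) \<and> x \<in> N x"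
  obtains S where "finite S" "S \<subseteq> topspace T" "topspace T \<subseteq> (\<Union>x\<in>S. N x)"
proof -
  have "\<exists>\<F>. finite \<F> \<and> \<F> \<subseteq> N ` topspace T \<and> topspace T \<subseteq> \<Union>\<F>"
    using assms(1)[unfolded compact_space_alt, rule_format, of "N ` topspace T"] assms(2) by blast
  then obtain \<F> where \<F>: "finite \<F>" "\<F> \<subseteq> N ` topspace T" "topspace T \<subseteq> \<Union>\<F>" by blast
  obtain S where "S \<subseteq> topspace T" "finite S" "\<F> = N ` S"
    using finite_subset_image[OF \<F>(1,2)] by blast
  with \<F>(3) show ?thesis by (intro that[of S]) auto
qed

lemma continuous_map_Max:
  assumes "finite S" "S \<noteq> {}" "\<And>s. s \<in> S \<Longrightarrow> continuous_map X euclideanreal (f s)"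
  shows "continuous_map X euclideanreal (\<lambda>x. Max ((\<lambda>s. f s x) ` S))"
  using assms
proof (induction rule: finite_ne_induct)
  case (insert s S)
  then have "(\<lambda>x. Max ((\<lambda>s. f s x) ` insert s S)) = (\<lambda>x. max (f s x) (Max ((\<lambda>s. f s x) ` S)))"
    by (intro ext) simp
  with insert show ?case by (simp add: continuous_map_real_max)
qed simp

section \<open>Functions that are continuous for the sigma-topology\<close>

context right_topological_group begin

text \<open>The universal property of the quotient. It trades \<open>sigma_topology\<close> for
  joint continuity on a product, where projections and compactness are at hand.\<close>

lemma sigma_continuous_iff:
  "continuous_map (sigma_topology G T) Z v \<longleftrightarrow>
     continuous_map (prod_topology T T) Z (\<lambda>p. v (inv (fst p) \<otimes> snd p))"
  using continuous_compose_quotient_map_eq[OF quotient_map_sigma_topology, of Z v]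
  by (simp add: o_def case_prod_unfold)

lemma sigma_continuous_imp_continuous:
  assumes "continuous_map (sigma_topology G T) Z v"
  shows "continuous_map T Z v"
proof (rule continuous_map_eq)
  have "continuous_map T (prod_topology T T) (\<lambda>y. (\<one>, y))"
    by (intro continuous_map_pairedI) (auto simp: topspace_eq)
  from continuous_map_compose[OF this assms[unfolded sigma_continuous_iff]]
  show "continuous_map T Z (\<lambda>y. v (inv \<one> \<otimes> y))" by (simp add: o_def)
qed (simp add: topspace_eq)

lemma continuous_right_translate:
  assumes "continuous_map T Z f" "g \<in> carrier G"
  shows "continuous_map T Z (\<lambda>x. f (x \<otimes> g))"
  using continuous_map_compose[OF continuous_right_mult[OF assms(2)] assms(1)] by (simp add: o_def)

lemma r_coset_eq_vimage:
  assumes "E \<subseteq> carrier G" "g \<in> carrier G"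
  shows "E #> g = {x \<in> carrier G. x \<otimes> inv g \<in> E}"
proof (intro subset_antisym subsetI)
  fix x assume "x \<in> E #> g"
  then show "x \<in> {x \<in> carrier G. x \<otimes> inv g \<in> E}"
    using assms by (auto simp: r_coset_def m_assoc subset_iff)
next
  fix x assume "x \<in> {x \<in> carrier G. x \<otimes> inv g \<in> E}"
  then show "x \<in> E #> g"
    using assms by (auto simp: r_coset_def m_assoc intro!: bexI[of _ "x \<otimes> inv g"])
qed

lemma openin_r_coset:
  assumes "openin T U" "g \<in> carrier G"
  shows "openin T (U #> g)"
  using openin_continuous_map_preimage[OF continuous_right_mult[OF inv_closed[OF assms(2)]] assms(1)]
    r_coset_eq_vimage[OF openin_subset[OF assms(1), unfolded topspace_eq] assms(2)]
  by (simp add: topspace_eq)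

lemma measurable_right_mult:
  assumes space: "space M = topspace T" and sets: "sets M = borel_sets T" and g: "g \<in> carrier G"
  shows "(\<lambda>x. x \<otimes> g) \<in> measurable M M"
proof (rule measurable_sigma_sets)
  show "sets M = sigma_sets (topspace T) {U. openin T U}" using sets by (simp add: borel_sets_def)
  show "{U. openin T U} \<subseteq> Pow (topspace T)" by (auto dest: openin_subset)
  show "(\<lambda>x. x \<otimes> g) \<in> space M \<rightarrow> topspace T" using g by (auto simp: space topspace_eq)
  fix U assume "U \<in> {U. openin T U}"
  then have "openin T {x \<in> topspace T. x \<otimes> g \<in> U}"
    using openin_continuous_map_preimage[OF continuous_right_mult[OF g]] by blast
  moreover have "(\<lambda>x. x \<otimes> g) -` U \<inter> space M = {x \<in> topspace T. x \<otimes> g \<in> U}"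
    by (auto simp: space)
  ultimately show "(\<lambda>x. x \<otimes> g) -` U \<inter> space M \<in> sets M"
    unfolding sets borel_sets_def by auto
qed

lemma r_coset_eq_vimage_space:
  assumes space: "space M = topspace T" and sets: "sets M = borel_sets T"
    and E: "E \<in> borel_sets T" and g: "g \<in> carrier G"
  shows "E #> g = (\<lambda>x. x \<otimes> inv g) -` E \<inter> space M" "E #> g \<in> borel_sets T"
proof -
  have "E \<subseteq> carrier G" using E sets space sets.sets_into_space topspace_eq by metis
  then show *: "E #> g = (\<lambda>x. x \<otimes> inv g) -` E \<inter> space M"
    using r_coset_eq_vimage[OF _ g] by (auto simp: space topspace_eq)
  show "E #> g \<in> borel_sets T"
    unfolding * using measurable_sets[OF measurable_right_mult[OF space sets inv_closed[OF g]]] E sets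
    by simp
qed

lemma sigma_continuous_right_translate:
  assumes v: "continuous_map (sigma_topology G T) Z v" and g: "g \<in> carrier G"
  shows "continuous_map (sigma_topology G T) Z (\<lambda>x. v (x \<otimes> g))"
  unfolding sigma_continuous_iff
proof (rule continuous_map_eq)
  have "continuous_map (prod_topology T T) T (\<lambda>p. snd p \<otimes> g)"
    using continuous_map_compose[OF continuous_map_snd continuous_right_mult[OF g]] by (simp add: o_def)
  then have "continuous_map (prod_topology T T) (prod_topology T T) (\<lambda>p. (fst p, snd p \<otimes> g))"
    by (intro continuous_map_pairedI continuous_map_fst)
  from continuous_map_compose[OF this v[unfolded sigma_continuous_iff]]
  show "continuous_map (prod_topology T T) Z (\<lambda>p. v (inv (fst p) \<otimes> (snd p \<otimes> g)))"
    by (simp add: o_def)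
qed (auto simp: topspace_eq m_assoc g)

text \<open>A tube argument: the pairs with \<open>w p \<ge> \<epsilon>\<close> form a closed set,
  and projecting it along the compact first factor gives a closed set of bad \<open>y\<close>. Since
  each \<open>x\<close> is an inverse, the first factor accounts for all of them.\<close>

lemma sigma_continuous_uniform_nbhd:
  fixes v :: "'a \<Rightarrow> real"
  assumes compact: "compact_space T" and v: "continuous_map (sigma_topology G T) euclideanreal v"
    and y0: "y0 \<in> carrier G"
  shows "openin T {y \<in> carrier G. \<forall>x\<in>carrier G. \<bar>v (x \<otimes> y) - v (x \<otimes> y0)\<bar> < \<epsilon>}"
proof -
  let ?P = "prod_topology T T"
  define w where "w p = \<bar>v (inv (fst p) \<otimes> snd p) - v (inv (fst p) \<otimes> y0)\<bar>" for p
  have "continuous_map ?P ?P (\<lambda>p. (fst p, y0))"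
    using y0 by (intro continuous_map_pairedI continuous_map_fst) (simp add: topspace_eq)
  from continuous_map_compose[OF this v[unfolded sigma_continuous_iff]]
  have "continuous_map ?P euclideanreal (\<lambda>p. v (inv (fst p) \<otimes> y0))" by (simp add: o_def)
  then have "continuous_map ?P euclideanreal w"
    unfolding w_def using v[unfolded sigma_continuous_iff]
    by (intro continuous_map_real_abs continuous_map_diff)
  then have "closedin ?P {p \<in> topspace ?P. w p \<in> {\<epsilon>..}}"
    by (rule closedin_continuous_map_preimage) simp
  then have "closedin T (snd ` {p \<in> topspace ?P. w p \<in> {\<epsilon>..}})"
    using closed_map_snd[OF compact, of T] by (simp add: closed_map_def)
  moreover have "topspace T - snd ` {p \<in> topspace ?P. w p \<in> {\<epsilon>..}}
      = {y \<in> carrier G. \<forall>x\<in>carrier G. \<bar>v (x \<otimes> y) - v (x \<otimes> y0)\<bar> < \<epsilon>}" (is "?L = ?R")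
  proof (intro subset_antisym subsetI)
    fix y assume y: "y \<in> ?L"
    have "\<bar>v (x \<otimes> y) - v (x \<otimes> y0)\<bar> < \<epsilon>" if "x \<in> carrier G" for x
    proof (rule ccontr)
      assume "\<not> \<bar>v (x \<otimes> y) - v (x \<otimes> y0)\<bar> < \<epsilon>"
      then have "(inv x, y) \<in> {p \<in> topspace ?P. w p \<in> {\<epsilon>..}}"
        using that y by (simp add: w_def topspace_eq)
      then have "y \<in> snd ` {p \<in> topspace ?P. w p \<in> {\<epsilon>..}}" by (rule rev_image_eqI) simp
      with y show False by blast
    qed
    then show "y \<in> ?R" using y by (simp add: topspace_eq)
  next
    fix y assume y: "y \<in> ?R"
    then have "w (a, y) < \<epsilon>" if "a \<in> carrier G" for a using that by (simp add: w_def)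
    then have "w p < \<epsilon>" if "p \<in> topspace ?P" "snd p = y" for p
      using that by (cases p) (simp add: topspace_eq)
    then show "y \<in> ?L" using y by (force simp: topspace_eq)
  qed
  ultimately show ?thesis by (metis openin_diff openin_topspace)
qed

text \<open>Joint continuity of \<open>v (x\<inverse> y)\<close> and compactness give a finite net of right translates;
  multiplying a second net by its members makes the estimate uniform on both sides.\<close>

lemma sigma_continuous_almost_periodic:
  assumes compact: "compact_space T" and v: "continuous_map (sigma_topology G T) euclideanreal v"
  shows "almost_periodic G v"
  unfolding almost_periodic_def
proof (intro allI impI)
  fix \<epsilon> :: real assume "\<epsilon> > 0"
  define N where "N y0 = {y \<in> carrier G. \<forall>x\<in>carrier G. \<bar>v (x \<otimes> y) - v (x \<otimes> y0)\<bar> < \<epsilon> / 3}" for y0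
  have N: "openin T (N y)" "y \<in> N y" if "y \<in> carrier G" for y
    unfolding N_def using sigma_continuous_uniform_nbhd[OF compact v that] that \<open>\<epsilon> > 0\<close> by (blast, simp)
  obtain Y where Y: "finite Y" "Y \<subseteq> carrier G" "carrier G \<subseteq> (\<Union>y\<in>Y. N y)"
    using compact_space_finite_nbhds[OF compact, of N] N unfolding topspace_eq by blast
  \<comment> \<open>These are the \<open>h\<close> that stay near \<open>g\<close> after right
    multiplication by each of the finitely many net points, an open condition because only right
    multiplications occur.\<close>
  define O' where "O' g = carrier G \<inter> (\<Inter>y\<in>Y. {h \<in> carrier G. h \<otimes> y \<in> N (g \<otimes> y)})" for g
  have "openin T (O' g) \<and> g \<in> O' g" if g: "g \<in> carrier G" for g
  proof
    have "openin T {h \<in> carrier G. h \<otimes> y \<in> N (g \<otimes> y)}" if "y \<in> Y" for y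
      using openin_continuous_map_preimage[OF continuous_right_mult N(1), of y "g \<otimes> y"] g that Y(2)
      by (auto simp: topspace_eq)
    then show "openin T (O' g)"
      unfolding O'_def using Y(1) openin_topspace[of T]
      by (cases "Y = {}") (auto simp: topspace_eq intro!: openin_Int openin_Inter)
    show "g \<in> O' g" unfolding O'_def using g Y(2) N(2) by auto
  qed
  then obtain S where S: "finite S" "S \<subseteq> carrier G" "carrier G \<subseteq> (\<Union>g\<in>S. O' g)"
    using compact_space_finite_nbhds[OF compact, of O'] unfolding topspace_eq by blast
  show "\<exists>S. finite S \<and> S \<subseteq> carrier G \<and> (\<forall>g\<in>carrier G. \<exists>s\<in>S. \<forall>x\<in>carrier G. \<forall>y\<in>carrier G.
      \<bar>v (x \<otimes> g \<otimes> y) - v (x \<otimes> s \<otimes> y)\<bar> \<le> \<epsilon>)"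
  proof (intro exI[of _ S] conjI S(1,2) ballI)
    fix g assume g: "g \<in> carrier G"
    then obtain s where s: "s \<in> S" "g \<in> O' s" using S(3) by blast
    then have sG: "s \<in> carrier G" using S(2) by blast
    have "\<bar>v (x \<otimes> g \<otimes> y) - v (x \<otimes> s \<otimes> y)\<bar> \<le> \<epsilon>" if x: "x \<in> carrier G" and y: "y \<in> carrier G" for x y
    proof -
      \<comment> \<open>The path is \<open>x g y\<close>, \<open>x g z\<close>,
        \<open>x s z\<close>, \<open>x s y\<close>, with a third of \<epsilon> for each leg.\<close>
      obtain z where z: "z \<in> Y" "y \<in> N z" using Y(3) y by blast
      then have zG: "z \<in> carrier G" using Y(2) by blast
      have "\<bar>v (x \<otimes> g \<otimes> y) - v (x \<otimes> g \<otimes> z)\<bar> < \<epsilon> / 3" "\<bar>v (x \<otimes> s \<otimes> y) - v (x \<otimes> s \<otimes> z)\<bar> < \<epsilon> / 3"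
        using z(2) x g sG unfolding N_def by auto
      moreover have "\<bar>v (x \<otimes> (g \<otimes> z)) - v (x \<otimes> (s \<otimes> z))\<bar> < \<epsilon> / 3"
        using s(2) z(1) x unfolding O'_def N_def by auto
      ultimately show ?thesis unfolding m_assoc[OF x g zG, symmetric] m_assoc[OF x sG zG, symmetric]
        by linarith
    qed
    then show "\<exists>s\<in>S. \<forall>x\<in>carrier G. \<forall>y\<in>carrier G. \<bar>v (x \<otimes> g \<otimes> y) - v (x \<otimes> s \<otimes> y)\<bar> \<le> \<epsilon>"
      using s(1) by blast
  qed
qed

end

text \<open>\<open>J\<close> stands for integration against a difference of two finite Radon
  measures. \<open>J_pos\<close> says that its positive part does not vanish, which for a non-zero
  difference can be arranged by exchanging the two measures.\<close>

locale sigma_functional = right_topological_group G T for G :: "('a, 'm) monoid_scheme" (structure) and T +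
  fixes J :: "('a \<Rightarrow> real) \<Rightarrow> real" and C :: real
  assumes compact: "compact_space T" and Hausdorff: "Hausdorff_space T"
    and J_add: "\<And>k l. continuous_map T euclideanreal k \<Longrightarrow> continuous_map T euclideanreal l \<Longrightarrow>
      J (\<lambda>x. k x + l x) = J k + J l"
    and J_bound: "\<And>k \<delta>. continuous_map T euclideanreal k \<Longrightarrow>
      (\<And>x. x \<in> carrier G \<Longrightarrow> \<bar>k x\<bar> \<le> \<delta>) \<Longrightarrow> J k \<le> C * \<delta>"
    and J_sigma: "\<And>k. continuous_map T euclideanreal k \<Longrightarrow>
      continuous_map (sigma_topology G T) euclideanreal (\<lambda>y. J (\<lambda>x. k (x \<otimes> y)))"
    and J_pos: "\<exists>k. continuous_map T euclideanreal k \<and> (\<forall>x\<in>carrier G. 0 \<le> k x \<and> k x \<le> 1) \<and> 0 < J k"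
begin

text \<open>\<open>J\<close> acts on total functions, while the group identities hold on the carrier
  only. \<open>J_bound\<close> at \<delta> = 0 disposes of the difference
  \<open>k - l\<close>.\<close>

lemma J_cong:
  assumes "continuous_map T euclideanreal k" "continuous_map T euclideanreal l"
    "\<And>x. x \<in> carrier G \<Longrightarrow> k x = l x"
  shows "J k = J l"
proof -
  have le: "J k \<le> J l" if "continuous_map T euclideanreal k" "continuous_map T euclideanreal l"
    "\<And>x. x \<in> carrier G \<Longrightarrow> k x = l x" for k l
  proof -
    have c: "continuous_map T euclideanreal (\<lambda>x. k x - l x)" using that by (intro continuous_map_diff)
    have "J (\<lambda>x. l x + (k x - l x)) = J l + J (\<lambda>x. k x - l x)" using that c by (intro J_add)
    moreover have "J (\<lambda>x. k x - l x) \<le> C * 0" using that c by (intro J_bound) auto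
    ultimately show ?thesis by simp
  qed
  show ?thesis using assms by (intro antisym le) auto
qed

lemma J_zero: "J (\<lambda>x. 0) = 0"
  using J_add[of "\<lambda>x. 0" "\<lambda>x. 0"] by simp

lemma ap: "continuous_map (sigma_topology G T) euclideanreal v \<Longrightarrow> almost_periodic G v"
  using compact by (rule sigma_continuous_almost_periodic)

definition between :: "('a \<Rightarrow> real) \<Rightarrow> ('a \<Rightarrow> real) set" where
  "between f = {k. continuous_map T euclideanreal k \<and> (\<forall>x\<in>carrier G. 0 \<le> k x \<and> k x \<le> f x)}"

text \<open>Strictness makes the inequality for a fixed \<open>k\<close> an open condition on
  \<open>y\<close>, as the covering argument in \<open>haar_add\<close> requires. The supremum of
  the means is not affected, since \<open>v\<close> may be lowered by a small constant.\<close>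

definition minorants :: "('a \<Rightarrow> real) \<Rightarrow> ('a \<Rightarrow> real) set" where
  "minorants f = {v. continuous_map (sigma_topology G T) euclideanreal v \<and>
     (\<forall>y\<in>carrier G. \<exists>k\<in>between f. v y < J (\<lambda>x. k (x \<otimes> y)))}"

text \<open>For fixed \<open>y\<close> the supremum of \<open>J (\<lambda>x. k (x \<otimes> y))\<close> over \<open>k \<in> between f\<close> is the positive
  variation of the \<open>y\<close>-translate of \<open>J\<close> at \<open>f\<close>; it is lower semicontinuous in \<open>y\<close>, and
  \<open>haar f\<close> is its lower mean.\<close>

definition haar :: "('a \<Rightarrow> real) \<Rightarrow> real" where
  "haar f = (SUP v\<in>minorants f. ap_mean v)"

lemma minorants_mean_le:
  assumes v: "v \<in> minorants f" and f: "\<And>x. x \<in> carrier G \<Longrightarrow> f x \<le> \<delta>"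
  shows "ap_mean v \<le> C * \<delta>"
proof -
  have "v y \<le> C * \<delta>" if y: "y \<in> carrier G" for y
  proof -
    obtain k where k: "k \<in> between f" "v y < J (\<lambda>x. k (x \<otimes> y))"
      using v y unfolding minorants_def by blast
    have "J (\<lambda>x. k (x \<otimes> y)) \<le> C * \<delta>"
    proof (rule J_bound)
      show "continuous_map T euclideanreal (\<lambda>x. k (x \<otimes> y))"
        using k(1) y by (simp add: between_def continuous_right_translate)
      fix x assume "x \<in> carrier G"
      then have xy: "x \<otimes> y \<in> carrier G" using y by simp
      then have "0 \<le> k (x \<otimes> y)" "k (x \<otimes> y) \<le> f (x \<otimes> y)" using k(1) by (auto simp: between_def)
      then show "\<bar>k (x \<otimes> y)\<bar> \<le> \<delta>" using f[OF xy] by linarith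
    qed
    with k(2) show ?thesis by simp
  qed
  then have "ap_mean v \<le> ap_mean (\<lambda>x. C * \<delta>)"
    using v by (intro ap_mean_mono ap almost_periodic_const) (auto simp: minorants_def)
  then show ?thesis by (simp add: ap_mean_const)
qed

lemma haar_upper:
  assumes "v \<in> minorants f" "continuous_map T euclideanreal f"
  shows "ap_mean v \<le> haar f"
proof -
  obtain B where "\<And>x. x \<in> carrier G \<Longrightarrow> f x \<le> B"
    using compact_space_bounded_above[OF compact assms(2)] unfolding topspace_eq by blast
  then have "bdd_above (ap_mean ` minorants f)"
    using minorants_mean_le by (intro bdd_aboveI2) blast
  then show ?thesis unfolding haar_def using assms(1) by (rule cSUP_upper2) simp
qed

text \<open>This keeps the supremum in \<open>haar\<close> over a non-empty set. The constant 0
  itself can fail the strict inequality, for instance when \<open>f\<close> is 0.\<close>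

lemma neg_const_minorant:
  assumes "\<And>x. x \<in> carrier G \<Longrightarrow> 0 \<le> f x" "\<eta> > 0"
  shows "(\<lambda>x. - \<eta>) \<in> minorants f"
  unfolding minorants_def between_def using assms
  by (auto intro!: bexI[of _ "\<lambda>x. 0"] exI[of _ "\<lambda>x. 0"] simp: J_zero)

lemma haar_least:
  assumes "\<And>x. x \<in> carrier G \<Longrightarrow> 0 \<le> f x" "\<And>v. v \<in> minorants f \<Longrightarrow> ap_mean v \<le> b"
  shows "haar f \<le> b"
  unfolding haar_def using assms neg_const_minorant[of f 1] by (intro cSUP_least) auto

lemma haar_nonneg:
  assumes "continuous_map T euclideanreal f" "\<And>x. x \<in> carrier G \<Longrightarrow> 0 \<le> f x"
  shows "0 \<le> haar f"
proof (rule field_le_epsilon)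
  fix e :: real assume "e > 0"
  then have "ap_mean (\<lambda>x. - e) \<le> haar f"
    using assms by (intro haar_upper neg_const_minorant)
  then show "0 \<le> haar f + e" by (simp add: ap_mean_const)
qed

lemma haar_const_le:
  assumes "0 \<le> \<delta>"
  shows "haar (\<lambda>x. \<delta>) \<le> C * \<delta>"
proof (rule haar_least)
  show "ap_mean v \<le> C * \<delta>" if "v \<in> minorants (\<lambda>x. \<delta>)" for v
    by (rule minorants_mean_le[OF that]) simp
qed (use assms in simp)

text \<open>\<open>between (\<lambda>x. 1)\<close> is stable under right translation, so one
  \<open>k\<close> with \<open>0 < J k\<close> serves at every \<open>y\<close> after translation by
  \<open>inv y\<close>. Halving \<open>J k\<close> leaves room for the strict inequality.\<close>

lemma haar_one_pos: "0 < haar (\<lambda>x. 1)"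
proof -
  obtain k where k: "k \<in> between (\<lambda>x. 1)" "0 < J k" using J_pos unfolding between_def by auto
  have "(\<lambda>x. J k / 2) \<in> minorants (\<lambda>x. 1)"
    unfolding minorants_def
  proof (intro CollectI conjI ballI)
    fix y assume y: "y \<in> carrier G"
    let ?l = "\<lambda>x. k (x \<otimes> inv y)"
    have l: "?l \<in> between (\<lambda>x. 1)"
      using k(1) y by (auto simp: between_def intro: continuous_right_translate)
    moreover have "J (\<lambda>x. ?l (x \<otimes> y)) = J k"
    proof (rule J_cong)
      show "continuous_map T euclideanreal k" using k by (simp add: between_def)
      show "continuous_map T euclideanreal (\<lambda>x. ?l (x \<otimes> y))"
        using l y by (intro continuous_right_translate[of _ ?l]) (auto simp: between_def)
    qed (use y in \<open>auto simp: m_assoc\<close>)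
    ultimately show "\<exists>l\<in>between (\<lambda>x. 1). J k / 2 < J (\<lambda>x. l (x \<otimes> y))"
      using k(2) by (intro bexI[of _ ?l]) auto
  qed simp
  then have "J k / 2 \<le> haar (\<lambda>x. 1)"
    using haar_upper[of "\<lambda>x. J k / 2"] by (simp add: ap_mean_const)
  then show ?thesis using k(2) by simp
qed

lemma minorants_add:
  assumes v: "v \<in> minorants f" and w: "w \<in> minorants g"
  shows "(\<lambda>x. v x + w x) \<in> minorants (\<lambda>x. f x + g x)"
  unfolding minorants_def
proof (intro CollectI conjI ballI)
  show "continuous_map (sigma_topology G T) euclideanreal (\<lambda>x. v x + w x)"
    using v w by (auto simp: minorants_def intro: continuous_map_add)
  fix y assume y: "y \<in> carrier G"
  obtain k l where kl: "k \<in> between f" "v y < J (\<lambda>x. k (x \<otimes> y))" "l \<in> between g" "w y < J (\<lambda>x. l (x \<otimes> y))"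
    using v w y unfolding minorants_def by blast
  have "J (\<lambda>x. k (x \<otimes> y) + l (x \<otimes> y)) = J (\<lambda>x. k (x \<otimes> y)) + J (\<lambda>x. l (x \<otimes> y))"
    using kl y by (intro J_add continuous_right_translate) (auto simp: between_def)
  moreover have "(\<lambda>x. k x + l x) \<in> between (\<lambda>x. f x + g x)"
    using kl by (auto simp: between_def intro: continuous_map_add add_mono)
  ultimately show "\<exists>k\<in>between (\<lambda>x. f x + g x). v y + w y < J (\<lambda>x. k (x \<otimes> y))"
    using kl by (intro bexI[of _ "\<lambda>x. k x + l x"]) auto
qed

text \<open>The Riesz decomposition of an order interval; the remainder is the positive part of
  \<open>k - f\<close>.\<close>

lemma between_decompose:
  assumes k: "k \<in> between (\<lambda>x. f x + g x)" and f: "continuous_map T euclideanreal f"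
    and "\<And>x. x \<in> carrier G \<Longrightarrow> 0 \<le> f x" "\<And>x. x \<in> carrier G \<Longrightarrow> 0 \<le> g x"
  shows "(\<lambda>x. min (k x) (f x)) \<in> between f" "(\<lambda>x. k x - min (k x) (f x)) \<in> between g"
proof -
  have k': "continuous_map T euclideanreal k" "\<And>x. x \<in> carrier G \<Longrightarrow> 0 \<le> k x \<and> k x \<le> f x + g x"
    using k by (auto simp: between_def)
  have m: "continuous_map T euclideanreal (\<lambda>x. min (k x) (f x))"
    using k'(1) f by (rule continuous_map_real_min)
  then show "(\<lambda>x. min (k x) (f x)) \<in> between f"
    using k'(2) assms(3) by (simp add: between_def)
  have "k x - min (k x) (f x) \<le> g x" if "x \<in> carrier G" for x
    using k'(2)[OF that] assms(4)[OF that] by (simp add: min_def)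
  then show "(\<lambda>x. k x - min (k x) (f x)) \<in> between g"
    using continuous_map_diff[OF k'(1) m] by (simp add: between_def)
qed

text \<open>A finite maximum stays sigma-continuous, unlike the full supremum that defines the
  variation; subtracting \<eta> makes the inequality strict.\<close>

lemma Max_minorant:
  assumes "finite S" "S \<noteq> {}" "\<And>s. s \<in> S \<Longrightarrow> k s \<in> between f" "\<eta> > 0"
  shows "(\<lambda>y. Max ((\<lambda>s. J (\<lambda>x. k s (x \<otimes> y))) ` S) - \<eta>) \<in> minorants f"
  unfolding minorants_def
proof (intro CollectI conjI ballI)
  show "continuous_map (sigma_topology G T) euclideanreal (\<lambda>y. Max ((\<lambda>s. J (\<lambda>x. k s (x \<otimes> y))) ` S) - \<eta>)"
    using assms by (intro continuous_map_diff continuous_map_Max J_sigma) (auto simp: between_def)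
  fix y
  have "Max ((\<lambda>s. J (\<lambda>x. k s (x \<otimes> y))) ` S) \<in> (\<lambda>s. J (\<lambda>x. k s (x \<otimes> y))) ` S"
    using assms(1,2) by (intro Max_in) auto
  then obtain s where "s \<in> S" "Max ((\<lambda>s. J (\<lambda>x. k s (x \<otimes> y))) ` S) = J (\<lambda>x. k s (x \<otimes> y))" by blast
  then show "\<exists>l\<in>between f. Max ((\<lambda>s. J (\<lambda>x. k s (x \<otimes> y))) ` S) - \<eta> < J (\<lambda>x. l (x \<otimes> y))"
    using assms(3,4) by (intro bexI[of _ "k s"]) auto
qed

text \<open>For the harder half, \<open>v\<close> lies below the variation at \<open>f + g\<close>
  through witnesses that depend on the point. Compactness leaves finitely many of them. Each is cut
  into a piece below \<open>f\<close> and a piece below \<open>g\<close>, and the maxima over the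
  pieces yield minorants \<open>v1\<close>, \<open>v2\<close> with
  \<open>v \<le> v1 + v2 + e\<close>.\<close>

lemma haar_add:
  assumes f: "continuous_map T euclideanreal f" "\<And>x. x \<in> carrier G \<Longrightarrow> 0 \<le> f x"
    and g: "continuous_map T euclideanreal g" "\<And>x. x \<in> carrier G \<Longrightarrow> 0 \<le> g x"
  shows "haar (\<lambda>x. f x + g x) = haar f + haar g"
proof (rule antisym)
  have fg: "continuous_map T euclideanreal (\<lambda>x. f x + g x)" "\<And>x. x \<in> carrier G \<Longrightarrow> 0 \<le> f x + g x"
    using f g by (auto intro: continuous_map_add)
  show "haar f + haar g \<le> haar (\<lambda>x. f x + g x)"
  proof -
    have sum: "ap_mean v + ap_mean w \<le> haar (\<lambda>x. f x + g x)"
      if "v \<in> minorants f" "w \<in> minorants g" for v w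
    proof -
      have "ap_mean (\<lambda>x. v x + w x) = ap_mean v + ap_mean w"
        using that minorants_add[OF that] by (intro ap_mean_add ap) (auto simp: minorants_def)
      then show ?thesis using haar_upper[OF minorants_add[OF that] fg(1)] by simp
    qed
    \<comment> \<open>The supremum over \<open>v\<close> is taken for fixed \<open>w\<close>, and
      then the one over \<open>w\<close>.\<close>
    have "haar f \<le> haar (\<lambda>x. f x + g x) - ap_mean w" if "w \<in> minorants g" for w
      using sum[OF _ that] f by (intro haar_least) (auto simp: algebra_simps)
    then have "haar g \<le> haar (\<lambda>x. f x + g x) - haar f"
      using g by (intro haar_least) (auto simp: algebra_simps)
    then show ?thesis by simp
  qed
  show "haar (\<lambda>x. f x + g x) \<le> haar f + haar g"
  proof (rule haar_least[OF fg(2)])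
    fix v assume v: "v \<in> minorants (\<lambda>x. f x + g x)"
    then have v_sigma: "continuous_map (sigma_topology G T) euclideanreal v" by (simp add: minorants_def)
    obtain k where k: "\<And>y. y \<in> carrier G \<Longrightarrow> k y \<in> between (\<lambda>x. f x + g x)"
      "\<And>y. y \<in> carrier G \<Longrightarrow> v y < J (\<lambda>x. k y (x \<otimes> y))"
      using v unfolding minorants_def by (simp add: Bex_def) metis
    define k1 where "k1 s = (\<lambda>x. min (k s x) (f x))" for s
    define k2 where "k2 s = (\<lambda>x. k s x - min (k s x) (f x))" for s
    have k12: "k1 s \<in> between f" "k2 s \<in> between g" if "s \<in> carrier G" for s
      unfolding k1_def k2_def using between_decompose[OF k(1)[OF that] f(1) f(2) g(2)] by auto
    define N where "N s = {y \<in> carrier G. v y < J (\<lambda>x. k s (x \<otimes> y))}" for s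
    have "openin T (N s) \<and> s \<in> N s" if s: "s \<in> carrier G" for s
    proof
      have "continuous_map (sigma_topology G T) euclideanreal (\<lambda>y. J (\<lambda>x. k s (x \<otimes> y)) - v y)"
        using k(1)[OF s] v_sigma by (intro continuous_map_diff J_sigma) (auto simp: between_def)
      then have "continuous_map T euclideanreal (\<lambda>y. J (\<lambda>x. k s (x \<otimes> y)) - v y)"
        by (rule sigma_continuous_imp_continuous)
      from openin_continuous_map_preimage[OF this, of "{0<..}"] show "openin T (N s)"
        by (simp add: N_def topspace_eq)
      show "s \<in> N s" using s k(2) by (simp add: N_def)
    qed
    then obtain S where S: "finite S" "S \<subseteq> carrier G" "carrier G \<subseteq> (\<Union>s\<in>S. N s)"
      using compact_space_finite_nbhds[OF compact, of N] unfolding topspace_eq by blast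
    have "S \<noteq> {}" using S(3) one_closed by blast
    show "ap_mean v \<le> haar f + haar g"
    proof (rule field_le_epsilon)
      fix e :: real assume "e > 0"
      \<comment> \<open>\<open>v1\<close> and \<open>v2\<close> are each lowered by this amount,
        which \<open>e\<close> makes up for.\<close>
      define \<eta> where "\<eta> = e / 2"
      have "\<eta> > 0" using \<open>e > 0\<close> by (simp add: \<eta>_def)
      define v1 where "v1 y = Max ((\<lambda>s. J (\<lambda>x. k1 s (x \<otimes> y))) ` S) - \<eta>" for y
      define v2 where "v2 y = Max ((\<lambda>s. J (\<lambda>x. k2 s (x \<otimes> y))) ` S) - \<eta>" for y
      have v12: "v1 \<in> minorants f" "v2 \<in> minorants g"
        unfolding v1_def v2_def using S \<open>S \<noteq> {}\<close> k12 \<open>\<eta> > 0\<close> by (auto intro!: Max_minorant)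
      have e_minorant: "(\<lambda>x. v1 x + v2 x) \<in> minorants (\<lambda>x. f x + g x)" by (rule minorants_add[OF v12])
      then have ap12: "almost_periodic G (\<lambda>x. v1 x + v2 x)" by (auto simp: minorants_def intro: ap)
      have ap12e: "almost_periodic G (\<lambda>x. v1 x + v2 x + e)"
        using e_minorant by (auto simp: minorants_def intro!: ap continuous_map_add)
      have "v y \<le> v1 y + v2 y + e" if y: "y \<in> carrier G" for y
      proof -
        obtain s where s: "s \<in> S" "y \<in> N s" using S(3) y by blast
        then have sG: "s \<in> carrier G" using S(2) by blast
        have "k s = (\<lambda>x. k1 s x + k2 s x)" by (simp add: k1_def k2_def)
        then have "J (\<lambda>x. k s (x \<otimes> y)) = J (\<lambda>x. k1 s (x \<otimes> y) + k2 s (x \<otimes> y))" by metis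
        also have "\<dots> = J (\<lambda>x. k1 s (x \<otimes> y)) + J (\<lambda>x. k2 s (x \<otimes> y))"
          using k12[OF sG] y by (intro J_add continuous_right_translate) (auto simp: between_def)
        also have "\<dots> \<le> (v1 y + \<eta>) + (v2 y + \<eta>)"
          unfolding v1_def v2_def using S(1) s(1) by (intro add_mono) (auto intro!: Max_ge)
        finally show ?thesis using s(2) unfolding N_def \<eta>_def by simp
      qed
      then have "ap_mean v \<le> ap_mean (\<lambda>x. v1 x + v2 x + e)"
        using ap[OF v_sigma] ap12e by (intro ap_mean_mono) auto
      also have "\<dots> = ap_mean v1 + ap_mean v2 + e"
        using ap_mean_add[OF ap12 almost_periodic_const ap12e] ap_mean_add[OF _ _ ap12] v12 ap
        by (simp add: ap_mean_const minorants_def)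
      also have "\<dots> \<le> haar f + haar g + e"
        using haar_upper[OF v12(1) f(1)] haar_upper[OF v12(2) g(1)] by simp
      finally show "ap_mean v \<le> haar f + haar g + e" .
    qed
  qed
qed

text \<open>If \<open>k\<close> is a witness for \<open>v\<close> at \<open>y \<otimes> g\<close>,
  then its translate by \<open>g\<close> is a witness for the translate of \<open>v\<close> at
  \<open>y\<close>.\<close>

lemma minorants_right_translate:
  assumes v: "v \<in> minorants f" and g: "g \<in> carrier G"
  shows "(\<lambda>x. v (x \<otimes> g)) \<in> minorants (\<lambda>x. f (x \<otimes> g))"
  unfolding minorants_def
proof (intro CollectI conjI ballI)
  show "continuous_map (sigma_topology G T) euclideanreal (\<lambda>x. v (x \<otimes> g))"
    using v g by (auto simp: minorants_def intro: sigma_continuous_right_translate)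
  fix y assume y: "y \<in> carrier G"
  then have "y \<otimes> g \<in> carrier G" using g by simp
  then obtain k where k: "k \<in> between f" "v (y \<otimes> g) < J (\<lambda>x. k (x \<otimes> (y \<otimes> g)))"
    using v unfolding minorants_def by blast
  have kg: "continuous_map T euclideanreal (\<lambda>x. k (x \<otimes> g))"
    using k(1) g by (intro continuous_right_translate) (auto simp: between_def)
  have "J (\<lambda>x. k (x \<otimes> (y \<otimes> g))) = J (\<lambda>x. k (x \<otimes> y \<otimes> g))"
  proof (rule J_cong)
    show "continuous_map T euclideanreal (\<lambda>x. k (x \<otimes> (y \<otimes> g)))"
      using k(1) g y by (intro continuous_right_translate) (auto simp: between_def)
    show "continuous_map T euclideanreal (\<lambda>x. k (x \<otimes> y \<otimes> g))"
      using continuous_right_translate[OF kg y] .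
  qed (use g y in \<open>auto simp: m_assoc\<close>)
  then show "\<exists>k\<in>between (\<lambda>x. f (x \<otimes> g)). v (y \<otimes> g) < J (\<lambda>x. k (x \<otimes> y))"
    using k kg g by (intro bexI[of _ "\<lambda>x. k (x \<otimes> g)"]) (auto simp: between_def)
qed

lemma haar_right_translate_ge:
  assumes f: "continuous_map T euclideanreal f" "\<And>x. x \<in> carrier G \<Longrightarrow> 0 \<le> f x" and g: "g \<in> carrier G"
  shows "haar f \<le> haar (\<lambda>x. f (x \<otimes> g))"
proof (rule haar_least[OF f(2)])
  fix v assume v: "v \<in> minorants f"
  have "ap_mean v = ap_mean (\<lambda>x. v (x \<otimes> g))"
    using v minorants_right_translate[OF v g] g
    by (intro ap_mean_right_translate[symmetric] ap) (auto simp: minorants_def)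
  also have "\<dots> \<le> haar (\<lambda>x. f (x \<otimes> g))"
    by (rule haar_upper[OF minorants_right_translate[OF v g] continuous_right_translate[OF f(1) g]])
  finally show "ap_mean v \<le> haar (\<lambda>x. f (x \<otimes> g))" .
qed

lemma haar_cong:
  assumes "\<And>x. x \<in> carrier G \<Longrightarrow> f x = g x"
  shows "haar f = haar g"
proof -
  have "between f = between g" unfolding between_def using assms by auto
  then show ?thesis unfolding haar_def minorants_def by simp
qed

lemma haar_right_translate:
  assumes f: "continuous_map T euclideanreal f" "\<And>x. x \<in> carrier G \<Longrightarrow> 0 \<le> f x" and g: "g \<in> carrier G"
  shows "haar (\<lambda>x. f (x \<otimes> g)) = haar f"
proof (rule antisym)
  have "haar (\<lambda>x. f (x \<otimes> g)) \<le> haar (\<lambda>x. f (x \<otimes> inv g \<otimes> g))"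
    using haar_right_translate_ge[of "\<lambda>x. f (x \<otimes> g)" "inv g"] continuous_right_translate[OF f(1) g] f(2) g
    by simp
  also have "\<dots> = haar f" using g by (intro haar_cong) (simp add: m_assoc)
  finally show "haar (\<lambda>x. f (x \<otimes> g)) \<le> haar f" .
qed (rule haar_right_translate_ge[OF f g])

lemma right_haar_measure_exists: "\<exists>M. right_haar_measure G T M"
proof -
  define c where "c = haar (\<lambda>x. 1)"
  have c: "c > 0" unfolding c_def by (rule haar_one_pos)
  \<comment> \<open>Dividing by the value at the constant 1 gives total mass 1.\<close>
  define \<Lambda> where "\<Lambda> f = haar f / c" for f
  interpret positive_functional T \<Lambda> "C / c"
  proof
    show "\<Lambda> (\<lambda>x. f x + g x) = \<Lambda> f + \<Lambda> g"
      if "continuous_map T euclideanreal f" "\<And>x. x \<in> topspace T \<Longrightarrow> 0 \<le> f x"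
         "continuous_map T euclideanreal g" "\<And>x. x \<in> topspace T \<Longrightarrow> 0 \<le> g x" for f g
      using that by (simp add: \<Lambda>_def haar_add topspace_eq add_divide_distrib)
    show "\<Lambda> (\<lambda>x. \<delta>) \<le> C / c * \<delta>" if "0 \<le> \<delta>" for \<delta>
      using divide_right_mono[OF haar_const_le[OF that], of c] c by (simp add: \<Lambda>_def)
  qed (use compact Hausdorff haar_nonneg c in \<open>auto simp: \<Lambda>_def topspace_eq\<close>)
  obtain M where M: "finite_radon_measure T M" "emeasure M (topspace T) = ennreal (\<Lambda> (\<lambda>x. 1))"
    "\<And>E. E \<in> borel_sets T \<Longrightarrow> emeasure M E = functional_outer T \<Lambda> E"
    using radon_measure_exists by blast
  \<comment> \<open>Translation by \<open>inv g\<close> carries test functions for \<open>U\<close>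
    to test functions for \<open>U #> g\<close> without changing \<Lambda>.\<close>
  have content: "functional_content T \<Lambda> U \<le> functional_content T \<Lambda> (U #> g)"
    if g: "g \<in> carrier G" and U: "U \<subseteq> carrier G" for U g
  proof (rule content_least)
    fix f assume f: "continuous_map T euclideanreal f" "\<And>x. x \<in> topspace T \<Longrightarrow> 0 \<le> f x"
      "\<And>x. x \<in> topspace T \<Longrightarrow> f x \<le> 1" "\<And>x. x \<in> topspace T \<Longrightarrow> x \<notin> U \<Longrightarrow> f x = 0"
    have "\<Lambda> f = \<Lambda> (\<lambda>x. f (x \<otimes> inv g))"
      unfolding \<Lambda>_def using haar_right_translate[OF f(1) f(2) inv_closed[OF g]] by (simp add: topspace_eq)
    also have "ennreal \<dots> \<le> functional_content T \<Lambda> (U #> g)"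
    proof (rule contentI)
      show "continuous_map T euclideanreal (\<lambda>x. f (x \<otimes> inv g))"
        using f(1) g by (intro continuous_right_translate) auto
      fix x assume x: "x \<in> topspace T"
      then have xg: "x \<otimes> inv g \<in> topspace T" using g by (simp add: topspace_eq)
      show "0 \<le> f (x \<otimes> inv g)" "f (x \<otimes> inv g) \<le> 1" using f(2,3)[OF xg] by auto
      show "f (x \<otimes> inv g) = 0" if "x \<notin> U #> g"
      proof (rule f(4)[OF xg], rule notI)
        assume "x \<otimes> inv g \<in> U"
        then have "x \<otimes> inv g \<otimes> g \<in> U #> g" unfolding r_coset_def by blast
        with that x g show False by (simp add: m_assoc topspace_eq)
      qed
    qed
    finally show "ennreal (\<Lambda> f) \<le> functional_content T \<Lambda> (U #> g)" .
  qed
  have outer: "functional_outer T \<Lambda> (E #> g) \<le> functional_outer T \<Lambda> E"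
    if g: "g \<in> carrier G" and E: "E \<subseteq> carrier G" for E g
    unfolding functional_outer_def[of _ _ E]
  proof (rule INF_greatest)
    fix U assume "U \<in> {U. openin T U \<and> E \<subseteq> U}"
    then have U: "openin T U" "E \<subseteq> U" by auto
    then have UG: "U \<subseteq> carrier G" using openin_subset topspace_eq by metis
    have "functional_outer T \<Lambda> (E #> g) \<le> functional_content T \<Lambda> (U #> g)"
      using U by (intro outer_le openin_r_coset[OF _ g]) (auto simp: r_coset_def)
    \<comment> \<open>Applied to \<open>U #> g\<close> and \<open>inv g\<close>, the inequality for
      contents gives its own reverse.\<close>
    also have "\<dots> \<le> functional_content T \<Lambda> (U #> g #> inv g)"
      using UG g by (intro content) (auto simp: r_coset_def)
    also have "U #> g #> inv g = U" using UG g by (simp add: coset_mult_assoc coset_mult_one)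
    finally show "functional_outer T \<Lambda> (E #> g) \<le> functional_content T \<Lambda> U" .
  qed
  have "emeasure M (E #> g) = emeasure M E" if g: "g \<in> carrier G" and E: "E \<in> borel_sets T" for g E
  proof -
    have sets: "sets M = borel_sets T" and space: "space M = carrier G"
      using M(1) by (auto simp: finite_radon_measure_def topspace_eq)
    have EG: "E \<subseteq> carrier G" using E sets space sets.sets_into_space by metis
    have Eg: "E #> g \<in> borel_sets T"
      using M(1) E g by (intro r_coset_eq_vimage_space(2)[of M]) (auto simp: finite_radon_measure_def)
    have EgG: "E #> g \<subseteq> carrier G" using EG g by (rule r_coset_subset_G)
    have "functional_outer T \<Lambda> E = functional_outer T \<Lambda> (E #> g #> inv g)"
      using EG g by (simp add: coset_mult_assoc coset_mult_one)
    also have "\<dots> \<le> functional_outer T \<Lambda> (E #> g)" using g EgG by (intro outer) auto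
    finally show ?thesis using outer[OF g EG] M(3)[OF E] M(3)[OF Eg] by simp
  qed
  moreover have "emeasure M (topspace T) = 1" using M(2) c by (simp add: \<Lambda>_def c_def)
  ultimately show ?thesis unfolding right_haar_measure_def using M(1) by blast
qed

end

section \<open>Jordan decomposition and uniqueness of Radon measures\<close>

lemma sigma_algebra_borel_sets: "sigma_algebra (topspace T) (borel_sets T)"
  unfolding borel_sets_def by (rule sigma_algebra_sigma_sets) (auto dest: openin_subset)

lemma openin_borel_sets: "openin T U \<Longrightarrow> U \<in> borel_sets T"
  by (auto simp: borel_sets_def)

lemma closedin_borel_sets:
  assumes "closedin T K"
  shows "K \<in> borel_sets T"
proof -
  interpret sigma_algebra "topspace T" "borel_sets T" by (rule sigma_algebra_borel_sets)
  have "topspace T - (topspace T - K) \<in> borel_sets T"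
    using assms by (intro compl_sets openin_borel_sets) auto
  then show ?thesis using closedin_subset[OF assms] by (simp add: double_diff)
qed

locale signed_borel =
  fixes T :: "'a topology" and \<nu> :: "'a set \<Rightarrow> real"
  assumes sums: "\<And>A :: nat \<Rightarrow> 'a set. range A \<subseteq> borel_sets T \<Longrightarrow> disjoint_family A \<Longrightarrow>
    (\<lambda>n. \<nu> (A n)) sums \<nu> (\<Union>n. A n)"
begin

sublocale borel: sigma_algebra "topspace T" "borel_sets T"
  by (rule sigma_algebra_borel_sets)

text \<open>A constant real series converges only if its term is 0.\<close>

lemma empty: "\<nu> {} = 0"
proof -
  have "(\<lambda>n::nat. \<nu> {}) sums \<nu> {}"
    using sums[of "\<lambda>n. {}"] by (simp add: disjoint_family_on_def)
  then have "summable (\<lambda>n::nat. \<nu> {})" by (rule sums_summable)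
  then show ?thesis by (simp add: summable_const_iff)
qed

lemma Un:
  assumes "A \<in> borel_sets T" "B \<in> borel_sets T" "A \<inter> B = {}"
  shows "\<nu> (A \<union> B) = \<nu> A + \<nu> B"
proof -
  have "(\<lambda>n. \<nu> (binaryset A B n)) sums \<nu> (\<Union>n. binaryset A B n)"
    using assms by (intro sums) (auto simp: range_binaryset_eq disjoint_family_on_def binaryset_def)
  moreover have "(\<lambda>n. \<nu> (binaryset A B n)) sums (\<nu> A + \<nu> B)"
    using binaryset_sums[of \<nu> A B] empty by simp
  ultimately show ?thesis by (simp add: UN_binaryset_eq sums_iff)
qed

lemma Diff:
  assumes "E \<in> borel_sets T" "F \<in> borel_sets T" "F \<subseteq> E"
  shows "\<nu> E = \<nu> F + \<nu> (E - F)"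
  using Un[of F "E - F"] assms by (simp add: borel.Diff Un_absorb1)

lemma signed_borel_uminus: "signed_borel T (\<lambda>E. - \<nu> E)"
  using sums by unfold_locales (intro sums_minus)

definition upper :: "'a set \<Rightarrow> ennreal" where
  "upper E = (SUP F\<in>{F \<in> borel_sets T. F \<subseteq> E}. ennreal (\<nu> F))"

lemma upper_ge: "F \<in> borel_sets T \<Longrightarrow> F \<subseteq> E \<Longrightarrow> ennreal (\<nu> F) \<le> upper E"
  unfolding upper_def by (intro SUP_upper) auto

lemma upper_mono: "A \<subseteq> B \<Longrightarrow> upper A \<le> upper B"
  unfolding upper_def by (intro SUP_subset_mono) auto

lemma upper_empty: "upper {} = 0"
proof -
  have "{F \<in> borel_sets T. F \<subseteq> {}} = {{}}" using borel.empty_sets by auto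
  then show ?thesis by (simp add: upper_def empty)
qed

lemma upper_superadditive:
  assumes "A \<inter> B = {}"
  shows "upper A + upper B \<le> upper (A \<union> B)"
proof -
  have *: "ennreal (\<nu> F) + ennreal (\<nu> G) \<le> upper (A \<union> B)"
    if F: "F \<in> borel_sets T" "F \<subseteq> A" and G: "G \<in> borel_sets T" "G \<subseteq> B" for F G
  proof (cases "0 \<le> \<nu> F \<and> 0 \<le> \<nu> G")
    case True
    then have "ennreal (\<nu> F) + ennreal (\<nu> G) = ennreal (\<nu> (F \<union> G))"
      using Un[OF F(1) G(1)] F G assms by (subst Un[OF F(1) G(1)]) auto
    also have "\<dots> \<le> upper (A \<union> B)" using F G by (intro upper_ge) auto
    finally show ?thesis .
  next
    \<comment> \<open>A negative value is truncated to 0, and the other set alone is then a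
      competitor for the union.\<close>
    case False
    moreover have "ennreal (\<nu> F) \<le> upper (A \<union> B)" "ennreal (\<nu> G) \<le> upper (A \<union> B)"
      using F G by (auto intro!: upper_ge)
    ultimately show ?thesis by (cases "0 \<le> \<nu> F") (auto simp: ennreal_neg)
  qed
  have ne: "{F \<in> borel_sets T. F \<subseteq> C} \<noteq> {}" for C using borel.empty_sets by auto
  have "ennreal (\<nu> F) + upper B \<le> upper (A \<union> B)" if "F \<in> borel_sets T" "F \<subseteq> A" for F
    unfolding upper_def[of B]
    by (subst ennreal_SUP_add_right[OF ne]) (use * that in \<open>auto intro!: SUP_least\<close>)
  then show ?thesis
    unfolding upper_def[of A]
    by (subst ennreal_SUP_add_left[OF ne, symmetric]) (auto intro!: SUP_least)
qed

text \<open>One inequality is superadditivity over finite unions. For the other, a competitor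
  \<open>F\<close> is cut along the \<open>A i\<close>; its value is the limit of real partial sums,
  and \<open>ennreal\<close> of such a sum is at most the sum of the truncated terms.\<close>

lemma upper_countably_additive: "countably_additive (borel_sets T) upper"
  unfolding countably_additive_def
proof (intro allI impI antisym)
  fix A :: "nat \<Rightarrow> 'a set" assume A: "range A \<subseteq> borel_sets T" "disjoint_family A"
  have "(\<Sum>i<n. upper (A i)) \<le> upper (\<Union>i<n. A i)" for n
  proof (induction n)
    case (Suc n)
    have "A i \<inter> A n = {}" if "i < n" for i
      using disjoint_family_onD[OF A(2), of i n] that by simp
    then have "(\<Union>i<n. A i) \<inter> A n = {}" by blast
    have "(\<Sum>i<Suc n. upper (A i)) \<le> upper (\<Union>i<n. A i) + upper (A n)"
      using Suc by (simp add: add_right_mono)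
    also have "\<dots> \<le> upper ((\<Union>i<n. A i) \<union> A n)"
      by (rule upper_superadditive) fact
    also have "(\<Union>i<n. A i) \<union> A n = (\<Union>i<Suc n. A i)" by (auto simp: less_Suc_eq)
    finally show ?case .
  qed simp
  also have "upper (\<Union>i<n. A i) \<le> upper (\<Union>i. A i)" for n by (rule upper_mono) auto
  finally show "(\<Sum>i. upper (A i)) \<le> upper (\<Union>i. A i)"
    unfolding suminf_eq_SUP by (rule SUP_least)
  show "upper (\<Union>i. A i) \<le> (\<Sum>i. upper (A i))"
    unfolding upper_def[of "\<Union>i. A i"]
  proof (rule SUP_least)
    fix F assume F: "F \<in> {F \<in> borel_sets T. F \<subseteq> (\<Union>i. A i)}"
    have FA: "F \<inter> A i \<in> borel_sets T" for i using F A(1) by auto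
    have "(\<lambda>i. \<nu> (F \<inter> A i)) sums \<nu> (\<Union>i. F \<inter> A i)"
      using FA A(2) by (intro sums) (auto simp: disjoint_family_on_def)
    moreover have "(\<Union>i. F \<inter> A i) = F" using F by auto
    ultimately have "(\<lambda>n. \<Sum>i<n. \<nu> (F \<inter> A i)) \<longlonglongrightarrow> \<nu> F" by (simp add: sums_def)
    then have "(\<lambda>n. ennreal (\<Sum>i<n. \<nu> (F \<inter> A i))) \<longlonglongrightarrow> ennreal (\<nu> F)" by (rule tendsto_ennrealI)
    moreover have "ennreal (\<Sum>i<n. \<nu> (F \<inter> A i)) \<le> (\<Sum>i. upper (A i))" for n
    proof -
      have "ennreal (\<Sum>i<n. \<nu> (F \<inter> A i)) \<le> (\<Sum>i<n. ennreal (\<nu> (F \<inter> A i)))"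
      proof (induction n)
        case (Suc n)
        have "ennreal (\<Sum>i<Suc n. \<nu> (F \<inter> A i)) \<le> ennreal (\<Sum>i<n. \<nu> (F \<inter> A i)) + ennreal (\<nu> (F \<inter> A n))"
          by (simp add: ennreal_plus_if ennreal_leI)
        also have "\<dots> \<le> (\<Sum>i<Suc n. ennreal (\<nu> (F \<inter> A i)))"
          unfolding sum.lessThan_Suc by (rule add_right_mono[OF Suc])
        finally show ?case .
      qed simp
      also have "\<dots> \<le> (\<Sum>i<n. upper (A i))" using FA by (intro sum_mono upper_ge) auto
      also have "\<dots> \<le> (\<Sum>i. upper (A i))" by (rule sum_le_suminf) auto
      finally show ?thesis .
    qed
    ultimately show "ennreal (\<nu> F) \<le> (\<Sum>i. upper (A i))" by (intro LIMSEQ_le_const2) auto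
  qed
qed

lemma pos_variation_eq: "pos_variation T \<nu> = measure_of (topspace T) (borel_sets T) upper"
  by (simp add: pos_variation_def upper_def[abs_def])

lemma sets_pos_variation: "sets (pos_variation T \<nu>) = borel_sets T"
  by (simp add: pos_variation_eq)

lemma emeasure_pos_variation:
  assumes "E \<in> borel_sets T"
  shows "emeasure (pos_variation T \<nu>) E = (SUP F\<in>{F \<in> borel_sets T. F \<subseteq> E}. ennreal (\<nu> F))"
  unfolding pos_variation_eq upper_def[symmetric]
  using assms borel.sigma_algebra_axioms upper_countably_additive
  by (intro emeasure_measure_of_sigma) (auto simp: positive_def upper_empty)

text \<open>Complementation inside \<open>E\<close> turns a bound on one variation into a bound on
  the other: \<open>\<nu> F = \<nu> E - \<nu> (E - F) \<le> \<nu> E + n\<close>. The Radon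
  hypotheses make both variations finite, so they can be subtracted.\<close>

lemma jordan_decomposition:
  assumes "finite_radon_measure T (pos_variation T \<nu>)" "finite_radon_measure T (neg_variation T \<nu>)"
    and E: "E \<in> borel_sets T"
  shows "\<nu> E = measure (pos_variation T \<nu>) E - measure (neg_variation T \<nu>) E"
proof -
  interpret neg: signed_borel T "\<lambda>E. - \<nu> E" by (rule signed_borel_uminus)
  define p where "p = measure (pos_variation T \<nu>) E"
  define n where "n = measure (neg_variation T \<nu>) E"
  have p: "emeasure (pos_variation T \<nu>) E = ennreal p" and n: "emeasure (neg_variation T \<nu>) E = ennreal n"
    using assms by (auto simp: p_def n_def finite_radon_measure_def finite_measure.emeasure_eq_measure)
  have "p \<ge> 0" "n \<ge> 0" by (simp_all add: p_def n_def)
  have p_le: "\<nu> F \<le> p" and n_le: "- \<nu> F \<le> n" if "F \<in> borel_sets T" "F \<subseteq> E" for F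
  proof -
    have "ennreal (\<nu> F) \<le> ennreal p"
      unfolding p[symmetric] emeasure_pos_variation[OF E] using that by (intro SUP_upper) auto
    then show "\<nu> F \<le> p" using \<open>p \<ge> 0\<close> by simp
    have "ennreal (- \<nu> F) \<le> ennreal n"
      unfolding n[symmetric] neg_variation_def neg.emeasure_pos_variation[OF E] using that by (intro SUP_upper) auto
    then show "- \<nu> F \<le> n" using \<open>n \<ge> 0\<close> by simp
  qed
  have "ennreal p \<le> ennreal (\<nu> E + n)"
    unfolding p[symmetric] emeasure_pos_variation[OF E]
  proof (intro SUP_least ennreal_leI)
    fix F assume F: "F \<in> {F \<in> borel_sets T. F \<subseteq> E}"
    then show "\<nu> F \<le> \<nu> E + n" using Diff[OF E, of F] n_le[of "E - F"] borel.Diff[OF E, of F] by force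
  qed
  then have "p \<le> \<nu> E + n" using n_le[OF E order_refl] by simp
  moreover have "ennreal n \<le> ennreal (p - \<nu> E)"
    unfolding n[symmetric] neg_variation_def neg.emeasure_pos_variation[OF E]
  proof (intro SUP_least ennreal_leI)
    fix F assume F: "F \<in> {F \<in> borel_sets T. F \<subseteq> E}"
    then show "- \<nu> F \<le> p - \<nu> E" using Diff[OF E, of F] p_le[of "E - F"] borel.Diff[OF E, of F] by force
  qed
  then have "n \<le> p - \<nu> E" using p_le[OF E order_refl] by simp
  ultimately show ?thesis by (simp add: p_def n_def)
qed

end

section \<open>Test functions determine a Radon measure\<close>

lemma continuous_map_borel_measurable:
  fixes f :: "'a \<Rightarrow> 'b::topological_space"
  assumes "space M = topspace T" "sets M = borel_sets T" "continuous_map T euclidean f"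
  shows "f \<in> borel_measurable M"
proof (rule borel_measurableI)
  fix S :: "'b set" assume "open S"
  then have "openin T {x \<in> topspace T. f x \<in> S}"
    using openin_continuous_map_preimage[OF assms(3)] by simp
  moreover have "f -` S \<inter> space M = {x \<in> topspace T. f x \<in> S}" using assms(1) by auto
  ultimately show "f -` S \<inter> space M \<in> sets M" using assms(2) openin_borel_sets by simp
qed

lemma finite_radon_measureD:
  assumes "finite_radon_measure T M"
  shows "space M = topspace T" "sets M = borel_sets T" "finite_measure M"
    "\<And>E. E \<in> borel_sets T \<Longrightarrow> emeasure M E = (SUP K\<in>{K. compactin T K \<and> K \<subseteq> E}. emeasure M K)"
  using assms by (auto simp: finite_radon_measure_def)

lemma integrable_continuous_map:
  fixes f :: "'a \<Rightarrow> real"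
  assumes "compact_space T" "finite_radon_measure T M" "continuous_map T euclideanreal f"
  shows "integrable M f"
proof -
  note M = finite_radon_measureD[OF assms(2)]
  obtain B where B: "\<And>x. x \<in> topspace T \<Longrightarrow> \<bar>f x\<bar> \<le> B"
    using compact_space_bounded_above[OF assms(1) continuous_map_real_abs[OF assms(3)]] by blast
  show ?thesis
    using continuous_map_borel_measurable[OF M(1,2) assms(3)] B M(1)
    by (intro finite_measure.integrable_const_bound[OF M(3), of _ B]) auto
qed

lemma radon_outer_regular_compact:
  assumes "compact_space T" "Hausdorff_space T" "finite_radon_measure T M" and K: "compactin T K" and "\<epsilon> > 0"
  obtains U where "openin T U" "K \<subseteq> U" "measure M U \<le> measure M K + \<epsilon>"
proof -
  note M = finite_radon_measureD[OF assms(3)]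
  interpret finite_measure M by (rule M(3))
  have closed: "closedin T L" if "compactin T L" for L
    using compactin_imp_closedin[OF assms(2) that] .
  have KM: "K \<in> sets M" using closed[OF K] closedin_borel_sets M(2) by blast
  define E where "E = topspace T - K"
  have E: "E \<in> borel_sets T" "E \<in> sets M"
    using KM M(1,2) sets.compl_sets[of K M] by (simp_all add: E_def)
  have "\<exists>L. compactin T L \<and> L \<subseteq> E \<and> measure M E < measure M L + \<epsilon>"
  proof (rule ccontr)
    assume *: "\<nexists>L. compactin T L \<and> L \<subseteq> E \<and> measure M E < measure M L + \<epsilon>"
    then have le: "measure M L \<le> measure M E - \<epsilon>" if "compactin T L" "L \<subseteq> E" for L
    proof -
      have "\<not> measure M E < measure M L + \<epsilon>" using * that by blast
      then show ?thesis by simp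
    qed
    \<comment> \<open>The empty compact set shows that the bound is nonnegative, so
      \<open>ennreal\<close> does not truncate it.\<close>
    have "0 \<le> measure M E - \<epsilon>" using le[of "{}"] by simp
    have "ennreal (measure M E) \<le> ennreal (measure M E - \<epsilon>)"
      unfolding emeasure_eq_measure[symmetric] M(4)[OF E(1)]
      using le by (intro SUP_least) (auto simp: emeasure_eq_measure intro!: ennreal_leI)
    with \<open>0 \<le> measure M E - \<epsilon>\<close> \<open>\<epsilon> > 0\<close> show False by simp
  qed
  then obtain L where L: "compactin T L" "L \<subseteq> E" "measure M E < measure M L + \<epsilon>" by blast
  have LM: "L \<in> sets M" using closed[OF L(1)] closedin_borel_sets M(2) by blast
  show ?thesis
  proof (rule that[of "topspace T - L"])
    show "openin T (topspace T - L)" using closed[OF L(1)] by auto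
    show "K \<subseteq> topspace T - L" using L(2) compactin_subset_topspace[OF K] by (auto simp: E_def)
    have "measure M (topspace T - L) = measure M (topspace T) - measure M L"
      "measure M E = measure M (topspace T) - measure M K"
      unfolding E_def using finite_measure_compl[OF LM] finite_measure_compl[OF KM] M(1) by simp_all
    then show "measure M (topspace T - L) \<le> measure M K + \<epsilon>" using L(3) by simp
  qed
qed

text \<open>A Urysohn function lies between the indicators of \<open>K\<close> and of an open
  \<open>U\<close> that is hardly larger than \<open>K\<close> for \<open>N\<close>, and its
  integral is the same for both measures.\<close>

lemma radon_measure_le_compact:
  assumes T: "compact_space T" "Hausdorff_space T" and P: "finite_radon_measure T P" and N: "finite_radon_measure T N"
    and eq: "\<And>k. continuous_map T euclideanreal k \<Longrightarrow> (\<And>x. x \<in> topspace T \<Longrightarrow> 0 \<le> k x \<and> k x \<le> 1) \<Longrightarrow>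
      integral\<^sup>L P k = integral\<^sup>L N k"
    and K: "compactin T K"
  shows "measure P K \<le> measure N K"
proof (rule field_le_epsilon)
  fix \<epsilon> :: real assume "\<epsilon> > 0"
  obtain U where U: "openin T U" "K \<subseteq> U" "measure N U \<le> measure N K + \<epsilon>"
    by (rule radon_outer_regular_compact[OF T N K \<open>\<epsilon> > 0\<close>])
  note P' = finite_radon_measureD[OF P] and N' = finite_radon_measureD[OF N]
  have normal: "normal_space T"
    using T by (intro compact_Hausdorff_or_regular_imp_normal_space) auto
  have "closedin T (topspace T - U)" "closedin T K" "disjnt (topspace T - U) K"
    using U K T(2) compactin_imp_closedin by (auto simp: disjnt_def)
  then obtain k where k: "continuous_map T (top_of_set {0..1::real}) k"
      "k ` (topspace T - U) \<subseteq> {0}" "k ` K \<subseteq> {1}"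
    by (rule Urysohn_lemma[OF normal _ _ _ zero_le_one])
  have kc: "continuous_map T euclideanreal k" and k01: "\<And>x. x \<in> topspace T \<Longrightarrow> 0 \<le> k x \<and> k x \<le> 1"
    using k(1) by (auto simp: continuous_map_in_subtopology image_subset_iff)
  have KX: "K \<subseteq> topspace T" and UX: "U \<subseteq> topspace T"
    using compactin_subset_topspace[OF K] openin_subset[OF U(1)] by auto
  have KP: "K \<in> sets P" and UN: "U \<in> sets N"
    using P'(2) N'(2) closedin_borel_sets[OF \<open>closedin T K\<close>] openin_borel_sets[OF U(1)] by auto
  have "measure P K = integral\<^sup>L P (indicator K)" using KX P'(1) by (simp add: Int_absorb2)
  also have "\<dots> \<le> integral\<^sup>L P k"
  proof (rule integral_mono)
    show "integrable P (indicator K :: 'a \<Rightarrow> real)"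
      using KP finite_measure.emeasure_finite[OF P'(3)] by (intro integrable_real_indicator) (auto simp: less_top[symmetric])
    show "indicator K x \<le> k x" if "x \<in> space P" for x
      using k(3) k01 that P'(1) by (auto simp: indicator_def)
  qed (rule integrable_continuous_map[OF T(1) P kc])
  also have "\<dots> = integral\<^sup>L N k" using kc k01 by (rule eq)
  also have "\<dots> \<le> integral\<^sup>L N (indicator U)"
  proof (rule integral_mono)
    show "integrable N (indicator U :: 'a \<Rightarrow> real)"
      using UN finite_measure.emeasure_finite[OF N'(3)] by (intro integrable_real_indicator) (auto simp: less_top[symmetric])
    show "k x \<le> indicator U x" if "x \<in> space N" for x
      using k(2) k01 that N'(1) by (auto simp: indicator_def)
  qed (rule integrable_continuous_map[OF T(1) N kc])
  also have "\<dots> = measure N U" using UX N'(1) by (simp add: Int_absorb2)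
  finally show "measure P K \<le> measure N K + \<epsilon>" using U(3) by simp
qed

text \<open>Inner regularity reduces the claim to compact sets. Contrapositively, distinct measures
  are told apart by a test function with values in [0,1], the shape that \<open>J_pos\<close> asks
  for.\<close>

lemma radon_measure_eqI:
  assumes T: "compact_space T" "Hausdorff_space T" and P: "finite_radon_measure T P" and N: "finite_radon_measure T N"
    and eq: "\<And>k. continuous_map T euclideanreal k \<Longrightarrow> (\<And>x. x \<in> topspace T \<Longrightarrow> 0 \<le> k x \<and> k x \<le> 1) \<Longrightarrow>
      integral\<^sup>L P k = integral\<^sup>L N k"
  shows "P = N"
proof (rule measure_eqI)
  note P' = finite_radon_measureD[OF P] and N' = finite_radon_measureD[OF N]
  show "sets P = sets N" using P'(2) N'(2) by simp
  fix E assume "E \<in> sets P"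
  then have E: "E \<in> borel_sets T" using P'(2) by simp
  have "measure P K = measure N K" if "compactin T K" for K
  proof (rule antisym)
    show "measure P K \<le> measure N K" by (rule radon_measure_le_compact[OF T P N eq that])
    show "measure N K \<le> measure P K" by (rule radon_measure_le_compact[OF T N P eq[symmetric] that])
  qed
  then have "emeasure P K = emeasure N K" if "compactin T K" for K
    using that P'(3) N'(3) by (simp add: finite_measure.emeasure_eq_measure)
  then show "emeasure P E = emeasure N E"
    unfolding P'(4)[OF E] N'(4)[OF E] by (intro SUP_cong) auto
qed

section \<open>Haar measures and \<open>M_sigma\<close>\<close>

context right_topological_group begin

lemma haar_of_difference_pos:
  assumes T: "compact_space T" "Hausdorff_space T" and P: "finite_radon_measure T P" and N: "finite_radon_measure T N"
    and sigma: "\<And>k. continuous_map T euclideanreal k \<Longrightarrow> continuous_map (sigma_topology G T) euclideanreal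
      (\<lambda>y. integral\<^sup>L P (\<lambda>x. k (x \<otimes> y)) - integral\<^sup>L N (\<lambda>x. k (x \<otimes> y)))"
    and k0: "continuous_map T euclideanreal k0" "\<And>x. x \<in> topspace T \<Longrightarrow> 0 \<le> k0 x \<and> k0 x \<le> 1"
      "integral\<^sup>L N k0 < integral\<^sup>L P k0"
  shows "\<exists>M. right_haar_measure G T M"
proof -
  define J where "J k = integral\<^sup>L P k - integral\<^sup>L N k" for k :: "'a \<Rightarrow> real"
  \<comment> \<open>Each of the two integrals is bounded by its own total mass.\<close>
  define C where "C = measure P (space P) + measure N (space N)"
  note P' = finite_radon_measureD[OF P] and N' = finite_radon_measureD[OF N]
  note intP = integrable_continuous_map[OF T(1) P] and intN = integrable_continuous_map[OF T(1) N]
  have bound: "\<bar>integral\<^sup>L M k\<bar> \<le> measure M (space M) * \<delta>"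
    if M: "finite_radon_measure T M" and k: "continuous_map T euclideanreal k"
      "\<And>x. x \<in> carrier G \<Longrightarrow> \<bar>k x\<bar> \<le> \<delta>" for M k \<delta>
  proof -
    interpret finite_measure M by (rule finite_radon_measureD(3)[OF M])
    have "\<bar>integral\<^sup>L M k\<bar> \<le> integral\<^sup>L M (\<lambda>x. \<bar>k x\<bar>)" by (rule integral_abs_bound)
    also have "\<dots> \<le> integral\<^sup>L M (\<lambda>x. \<delta>)"
      using k integrable_continuous_map[OF T(1) M k(1)] finite_radon_measureD(1)[OF M]
      by (intro integral_mono) (auto simp: topspace_eq)
    finally show ?thesis by simp
  qed
  interpret sigma_functional G T J C
  proof
    fix k l :: "'a \<Rightarrow> real" assume k: "continuous_map T euclideanreal k"
    show "J (\<lambda>x. k x + l x) = J k + J l" if l: "continuous_map T euclideanreal l"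
      using intP[OF k] intP[OF l] intN[OF k] intN[OF l] by (simp add: J_def)
    show "J k \<le> C * \<delta>" if "\<And>x. x \<in> carrier G \<Longrightarrow> \<bar>k x\<bar> \<le> \<delta>" for \<delta>
      using bound[OF P k that] bound[OF N k that] by (simp add: J_def C_def distrib_right abs_le_iff)
    show "continuous_map (sigma_topology G T) euclideanreal (\<lambda>y. J (\<lambda>x. k (x \<otimes> y)))"
      unfolding J_def by (rule sigma[OF k])
  next
    show "\<exists>k. continuous_map T euclideanreal k \<and> (\<forall>x\<in>carrier G. 0 \<le> k x \<and> k x \<le> 1) \<and> 0 < J k"
      using k0 by (intro exI[of _ k0]) (auto simp: J_def topspace_eq)
  qed (use T in auto)
  show ?thesis by (rule right_haar_measure_exists)
qed

text \<open>A test function that tells \<open>P\<close> from \<open>N\<close> may give the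
  difference the wrong sign; the continuity hypothesis survives a change of sign, so the two
  measures can be exchanged.\<close>

lemma haar_of_difference:
  assumes T: "compact_space T" "Hausdorff_space T" and P: "finite_radon_measure T P" and N: "finite_radon_measure T N"
    and sigma: "\<And>k. continuous_map T euclideanreal k \<Longrightarrow> continuous_map (sigma_topology G T) euclideanreal
      (\<lambda>y. integral\<^sup>L P (\<lambda>x. k (x \<otimes> y)) - integral\<^sup>L N (\<lambda>x. k (x \<otimes> y)))"
    and "P \<noteq> N"
  shows "\<exists>M. right_haar_measure G T M"
proof -
  obtain k0 where k0: "continuous_map T euclideanreal k0" "\<And>x. x \<in> topspace T \<Longrightarrow> 0 \<le> k0 x \<and> k0 x \<le> 1"
    "integral\<^sup>L P k0 \<noteq> integral\<^sup>L N k0"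
    using radon_measure_eqI[OF T P N] \<open>P \<noteq> N\<close> by blast
  show ?thesis
  proof (cases "integral\<^sup>L N k0 < integral\<^sup>L P k0")
    case True
    then show ?thesis by (intro haar_of_difference_pos[OF T P N sigma k0(1,2)])
  next
    case False
    then have "integral\<^sup>L P k0 < integral\<^sup>L N k0" using k0(3) by simp
    moreover have "continuous_map (sigma_topology G T) euclideanreal
        (\<lambda>y. integral\<^sup>L N (\<lambda>x. k (x \<otimes> y)) - integral\<^sup>L P (\<lambda>x. k (x \<otimes> y)))"
      if "continuous_map T euclideanreal k" for k
      using continuous_map_minus[OF sigma[OF that]] by simp
    ultimately show ?thesis by (intro haar_of_difference_pos[OF T N P _ k0(1,2)])
  qed
qed

text \<open>The real or the imaginary part of \<open>\<mu>\<close> is non-zero at some Borel set, so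
  by the Jordan decomposition its two variations differ there.\<close>

lemma haar_of_M_sigma:
  assumes T: "compact_space T" "Hausdorff_space T" and \<mu>: "\<mu> \<in> M_sigma G T" "\<mu> \<noteq> (\<lambda>E. 0)"
  shows "\<exists>M. right_haar_measure G T M"
proof -
  let ?re = "\<lambda>E. Re (\<mu> E)" and ?im = "\<lambda>E. Im (\<mu> E)"
  have \<mu>_radon: "\<mu> \<in> complex_radon_measures T" using \<mu>(1) by (simp add: M_sigma_def)
  then have radon: "finite_radon_measure T (pos_variation T ?re)" "finite_radon_measure T (neg_variation T ?re)"
    "finite_radon_measure T (pos_variation T ?im)" "finite_radon_measure T (neg_variation T ?im)"
    and off: "\<And>E. E \<notin> borel_sets T \<Longrightarrow> \<mu> E = 0"
    and \<mu>_sums: "\<And>A :: nat \<Rightarrow> 'a set. range A \<subseteq> borel_sets T \<Longrightarrow> disjoint_family A \<Longrightarrow>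
      (\<lambda>n. \<mu> (A n)) sums \<mu> (\<Union>n. A n)"
    by (auto simp: complex_radon_measures_def)
  interpret re: signed_borel T ?re
    using \<mu>_sums by unfold_locales (rule sums_Re)
  interpret im: signed_borel T ?im
    using \<mu>_sums by unfold_locales (rule sums_Im)
  have sigma: "continuous_map (sigma_topology G T) euclidean
      (\<lambda>y. complex_integral T \<mu> (\<lambda>x. complex_of_real (k (x \<otimes> y))))"
    if "continuous_map T euclideanreal k" for k
  proof -
    have "continuous_map T euclidean (\<lambda>x. complex_of_real (k x))"
      using continuous_map_compose[OF that, of euclidean complex_of_real]
      by (simp add: o_def continuous_on_of_real)
    then show ?thesis
      using \<mu>(1) by (auto simp: M_sigma_def cont_functions_def fun_measure_act_def[abs_def]
          dest!: spec[of _ "\<lambda>x. complex_of_real (k x)"])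
  qed
  have Re_cont: "continuous_map (sigma_topology G T) euclideanreal (\<lambda>y. Re (h y))"
    and Im_cont: "continuous_map (sigma_topology G T) euclideanreal (\<lambda>y. Im (h y))"
    if "continuous_map (sigma_topology G T) euclidean h" for h
    using continuous_map_compose[OF that, of euclideanreal Re] continuous_map_compose[OF that, of euclideanreal Im]
    by (simp_all add: o_def continuous_on_Re continuous_on_Im)
  obtain E where "\<mu> E \<noteq> 0" using \<mu>(2) by auto
  then have E: "E \<in> borel_sets T" using off by blast
  consider "?re E \<noteq> 0" | "?im E \<noteq> 0" using \<open>\<mu> E \<noteq> 0\<close> by (auto simp: complex_eq_iff)
  then show ?thesis
  proof cases
    case 1
    then have "pos_variation T ?re \<noteq> neg_variation T ?re"
      using re.jordan_decomposition[OF radon(1,2) E] by auto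
    \<comment> \<open>For real \<open>k\<close> all four integrals in
      \<open>complex_integral\<close> are real, so \<open>Re\<close> isolates the first two of
      them.\<close>
    moreover have "continuous_map (sigma_topology G T) euclideanreal
        (\<lambda>y. integral\<^sup>L (pos_variation T ?re) (\<lambda>x. k (x \<otimes> y)) - integral\<^sup>L (neg_variation T ?re) (\<lambda>x. k (x \<otimes> y)))"
      if "continuous_map T euclideanreal k" for k
      using Re_cont[OF sigma[OF that]] by (simp add: complex_integral_def)
    ultimately show ?thesis using haar_of_difference[OF T radon(1,2)] by blast
  next
    case 2
    then have "pos_variation T ?im \<noteq> neg_variation T ?im"
      using im.jordan_decomposition[OF radon(3,4) E] by auto
    moreover have "continuous_map (sigma_topology G T) euclideanreal
        (\<lambda>y. integral\<^sup>L (pos_variation T ?im) (\<lambda>x. k (x \<otimes> y)) - integral\<^sup>L (neg_variation T ?im) (\<lambda>x. k (x \<otimes> y)))"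
      if "continuous_map T euclideanreal k" for k
      using Im_cont[OF sigma[OF that]] by (simp add: complex_integral_def)
    ultimately show ?thesis using haar_of_difference[OF T radon(3,4)] by blast
  qed
qed

text \<open>The push-forward of \<open>M\<close> under right multiplication by \<open>y\<close> is
  \<open>M\<close>, because the preimage of \<open>E\<close> is its coset by
  \<open>inv y\<close>.\<close>

lemma haar_integral_right_translate:
  fixes f :: "'a \<Rightarrow> 'c::{banach, second_countable_topology}"
  assumes M: "right_haar_measure G T M" and f: "continuous_map T euclidean f" and y: "y \<in> carrier G"
  shows "integral\<^sup>L M (\<lambda>x. f (x \<otimes> y)) = integral\<^sup>L M f"
proof -
  have M': "space M = topspace T" "sets M = borel_sets T"
    using M by (auto simp: right_haar_measure_def finite_radon_measure_def)
  note meas = measurable_right_mult[OF M' y]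
  have "distr M M (\<lambda>x. x \<otimes> y) = M"
  proof (rule measure_eqI)
    fix E assume "E \<in> sets (distr M M (\<lambda>x. x \<otimes> y))"
    then have E: "E \<in> borel_sets T" using M'(2) by simp
    have "emeasure (distr M M (\<lambda>x. x \<otimes> y)) E = emeasure M ((\<lambda>x. x \<otimes> y) -` E \<inter> space M)"
      using E M'(2) by (intro emeasure_distr meas) simp
    also have "(\<lambda>x. x \<otimes> y) -` E \<inter> space M = E #> inv y"
      using r_coset_eq_vimage_space(1)[OF M' E inv_closed[OF y]] y by simp
    also have "emeasure M (E #> inv y) = emeasure M E"
      using M E y by (simp add: right_haar_measure_def)
    finally show "emeasure (distr M M (\<lambda>x. x \<otimes> y)) E = emeasure M E" .
  qed simp
  then show ?thesis
    using integral_distr[OF meas continuous_map_borel_measurable[OF M' f]] by simp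
qed

lemma M_sigma_of_haar:
  assumes M: "right_haar_measure G T M"
  shows "\<exists>\<mu>\<in>M_sigma G T. \<mu> \<noteq> (\<lambda>E. 0)"
proof -
  have radon: "finite_radon_measure T M" and one: "emeasure M (topspace T) = 1"
    using M by (auto simp: right_haar_measure_def)
  note M' = finite_radon_measureD[OF radon]
  interpret finite_measure M by (rule M'(3))
  \<comment> \<open>The value 0 off the Borel sets is the normalisation in
    \<open>complex_radon_measures\<close>.\<close>
  define m where "m E = (if E \<in> borel_sets T then measure M E else 0)" for E
  define \<mu> where "\<mu> E = complex_of_real (m E)" for E
  have m_sums: "(\<lambda>n. m (A n)) sums m (\<Union>n. A n)"
    if "range A \<subseteq> borel_sets T" "disjoint_family A" for A :: "nat \<Rightarrow> 'a set"
  proof -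
    have "range A \<subseteq> sets M" using that(1) M'(2) by simp
    then have "(\<Union>n. A n) \<in> borel_sets T" using sets.countable_UN[OF \<open>range A \<subseteq> sets M\<close>] M'(2) by simp
    moreover have "\<And>n. A n \<in> borel_sets T" using that(1) by auto
    ultimately show ?thesis
      using finite_measure_UNION[OF \<open>range A \<subseteq> sets M\<close> that(2)] by (simp add: m_def)
  qed
  interpret m: signed_borel T m by unfold_locales (rule m_sums)
  interpret z: signed_borel T "\<lambda>E. 0" by unfold_locales simp
  have empty: "{} \<in> borel_sets T" by (rule m.borel.empty_sets)
  have pos: "pos_variation T m = M"
  proof (rule measure_eqI)
    fix E assume "E \<in> sets (pos_variation T m)"
    then have E: "E \<in> borel_sets T" by (simp add: m.sets_pos_variation)
    show "emeasure (pos_variation T m) E = emeasure M E"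
      unfolding m.emeasure_pos_variation[OF E]
    proof (intro antisym SUP_least)
      fix F assume F: "F \<in> {F \<in> borel_sets T. F \<subseteq> E}"
      then have "ennreal (m F) = emeasure M F" by (simp add: m_def emeasure_eq_measure)
      also have "\<dots> \<le> emeasure M E" using F E M'(2) by (intro emeasure_mono) auto
      finally show "ennreal (m F) \<le> emeasure M E" .
    next
      have "emeasure M E = ennreal (m E)" using E by (simp add: m_def emeasure_eq_measure)
      also have "\<dots> \<le> (SUP F\<in>{F \<in> borel_sets T. F \<subseteq> E}. ennreal (m F))"
        using E by (intro SUP_upper) auto
      finally show "emeasure M E \<le> (SUP F\<in>{F \<in> borel_sets T. F \<subseteq> E}. ennreal (m F))" .
    qed
  qed (simp add: m.sets_pos_variation M'(2))
  \<comment> \<open>This covers the three variations that vanish: the negative one of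
    \<open>m\<close> and both of the zero imaginary part.\<close>
  have null: "pos_variation T \<nu> = null_measure M"
    if "signed_borel T \<nu>" "\<And>E. \<nu> E \<le> 0" for \<nu>
  proof -
    interpret signed_borel T \<nu> by fact
    show ?thesis
    proof (rule measure_eqI)
      fix E assume "E \<in> sets (pos_variation T \<nu>)"
      then have E: "E \<in> borel_sets T" by (simp add: sets_pos_variation)
      show "emeasure (pos_variation T \<nu>) E = emeasure (null_measure M) E"
        unfolding emeasure_pos_variation[OF E] using that(2) empty
        by (auto simp: ennreal_neg intro!: SUP_eq_const)
    qed (simp add: sets_pos_variation M'(2))
  qed
  have neg: "neg_variation T m = null_measure M"
    unfolding neg_variation_def by (rule null[OF m.signed_borel_uminus]) (simp add: m_def)
  have zero: "pos_variation T (\<lambda>E. 0) = null_measure M" "neg_variation T (\<lambda>E. 0) = null_measure M"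
    unfolding neg_variation_def using null[OF z.signed_borel_axioms] by simp_all
  have "{K. compactin T K \<and> K \<subseteq> E} \<noteq> {}" for E :: "'a set"
    by (auto intro!: exI[of _ "{}"])
  then have null_radon: "finite_radon_measure T (null_measure M)"
    unfolding finite_radon_measure_def using M'(1,2) by (auto intro!: finite_measureI)
  have integral: "complex_integral T \<mu> f = integral\<^sup>L M f" for f
    by (simp add: complex_integral_def \<mu>_def pos neg zero)
  have "\<mu> \<in> complex_radon_measures T"
    unfolding complex_radon_measures_def using m_sums radon null_radon
    by (simp add: \<mu>_def pos neg zero sums_of_real_iff) (simp add: m_def)
  moreover have "fun_measure_act G T f \<mu> \<in> cont_functions (sigma_topology G T)"
    if "f \<in> cont_functions T" for f
    unfolding cont_functions_def
  proof (rule CollectI, rule continuous_map_eq)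
    show "continuous_map (sigma_topology G T) euclidean (\<lambda>y. integral\<^sup>L M f)" by simp
    show "integral\<^sup>L M f = fun_measure_act G T f \<mu> y" if "y \<in> topspace (sigma_topology G T)" for y
      using haar_integral_right_translate[OF M, of f y] that \<open>f \<in> cont_functions T\<close>
      by (simp add: fun_measure_act_def integral topspace_sigma_topology cont_functions_def)
  qed
  ultimately have "\<mu> \<in> M_sigma G T" by (simp add: M_sigma_def)
  moreover have "\<mu> (topspace T) \<noteq> 0"
    using one openin_borel_sets[of T "topspace T"] by (simp add: \<mu>_def m_def measure_def)
  then have "\<mu> \<noteq> (\<lambda>E. 0)" by auto
  ultimately show ?thesis by blast
qed

end

theorem theorem4p11:
  fixes G :: "('a, 'm) monoid_scheme" and T :: "'a topology"
  assumes "right_topological_group G T"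
    and "compact_space T"
    and "Hausdorff_space T"
  shows "(\<exists>M. right_haar_measure G T M) \<longleftrightarrow> (\<exists>\<mu>\<in>M_sigma G T. \<mu> \<noteq> (\<lambda>E. 0))"
proof -
  interpret right_topological_group G T by fact
  show ?thesis using M_sigma_of_haar haar_of_M_sigma[OF assms(2,3)] by blast
qed

end
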